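(* Let $a,b\ge 0$ be integers, and put $m=b-a-1$, $n=(a+2)(b+1)$ and $$A_{m,n}=\begin{pmatrix}0&1&0\\0&0&1\\1&-m&-n\end{pmatrix}.$$ Consider the sail of the two-dimensional continued fraction associated to $A_{m,n}$ that lies in the orthant containing the point $(0,0,1)$. Let $A=(1,0,a+2)$, $B=(0,0,1)$, $C=(b-a-1,1,0)$, $D=((b+1)^2,b+1,1)$. Then the following set of faces forms a fundamental domain of this sail: the vertex $A$; the (open) edges $AB$, $AD$, $BD$; and the (open) triangular faces $ABD$ and $BDC$.
   Context: For an operator $M\in SL(3,\mathbb Z)$ with real pairwise distinct eigenvalues and irreducible characteristic polynomial, the three planes spanned by pairs of eigenvectors divide $\mathbb R^3$ into $8$ open orthants; the sail of an orthant is the boundary of the convex hull of all integer points other than the origin in the closure of the orthant, and the set of the $8$ sails is the continued fraction associated to $M$. $\bar\Xi(M)$ denotes the group of integer matrices of determinant $1$ commuting with $M$ and having all eigenvalues positive real; it maps each sail onto itself. A fundamental domain of a sail is a union of faces of the sail containing exactly one face from each orbit of $\bar\Xi(M)$ acting on the faces of the sail. *)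

theory Defs
  imports "HOL-Analysis.Analysis" "HOL-Computational_Algebra.Computational_Algebra"
begin

text \<open>Operators in \<open>SL(3,\<int>)\<close> are integer matrices, acting on \<open>\<real>\<^sup>3\<close> through
  \<open>map_matrix real_of_int\<close>.\<close>

definition charpoly :: "'a::comm_ring_1^3^3 \<Rightarrow> 'a poly" where
  "charpoly M = det (mat [:0, 1:] - map_matrix (\<lambda>x. [:x:]) M)"

definition cf_operator :: "int^3^3 \<Rightarrow> bool" where
  "cf_operator M \<longleftrightarrow> det M = 1 \<and>
     card {x::real. poly (map_poly of_int (charpoly M)) x = 0} = 3 \<and>
     irreducible (map_poly rat_of_int (charpoly M))"

definition eigenvector :: "int^3^3 \<Rightarrow> real^3 \<Rightarrow> bool" where
  "eigenvector M v \<longleftrightarrow> v \<noteq> 0 \<and> (\<exists>l::real. map_matrix real_of_int M *v v = l *\<^sub>R v)"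

definition eigenplanes :: "int^3^3 \<Rightarrow> (real^3) set set" where
  "eigenplanes M = {span {v, w} | v w. eigenvector M v \<and> eigenvector M w \<and> w \<notin> span {v}}"

definition orthants :: "int^3^3 \<Rightarrow> (real^3) set set" where
  "orthants M = components (- \<Union>(eigenplanes M))"

text \<open>The orthant containing \<open>p\<close>; empty if \<open>p\<close> lies on one of the planes.\<close>

definition orthant_at :: "int^3^3 \<Rightarrow> real^3 \<Rightarrow> (real^3) set" where
  "orthant_at M p = connected_component_set (- \<Union>(eigenplanes M)) p"

lemma orthant_at_eq_iff:
  "p \<notin> \<Union>(eigenplanes M) \<and> Q = orthant_at M p \<longleftrightarrow> Q \<in> orthants M \<and> p \<in> Q"
proof
  assume "p \<notin> \<Union>(eigenplanes M) \<and> Q = orthant_at M p"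
  then show "Q \<in> orthants M \<and> p \<in> Q"
    unfolding orthants_def orthant_at_def by (auto simp: components_def connected_component_refl_eq)
next
  assume Q: "Q \<in> orthants M \<and> p \<in> Q"
  then have "p \<notin> \<Union>(eigenplanes M)"
    unfolding orthants_def using in_components_subset by blast
  moreover have "Q = orthant_at M p"
    using Q unfolding orthants_def orthant_at_def components_def
    by (auto intro: connected_component_trans connected_component_sym)
  ultimately show "p \<notin> \<Union>(eigenplanes M) \<and> Q = orthant_at M p" by blast
qed

definition integer_points :: "(real^3) set" where
  "integer_points = {p. \<forall>i. p $ i \<in> \<int>}"

definition sail_hull :: "(real^3) set \<Rightarrow> (real^3) set" where
  "sail_hull Q = convex hull (integer_points \<inter> closure Q - {0})"

definition sail :: "(real^3) set \<Rightarrow> (real^3) set" where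
  "sail Q = frontier (sail_hull Q)"

text \<open>Faces of all dimensions (vertices, edges, two-dimensional faces) are taken relatively
  open, so that they partition the sail; a vertex is its own relative interior.\<close>

definition sail_faces :: "(real^3) set \<Rightarrow> (real^3) set set" where
  "sail_faces Q = {rel_interior F | F. F face_of sail_hull Q \<and> F \<noteq> {} \<and> F \<subseteq> sail Q}"

definition Xi_bar :: "int^3^3 \<Rightarrow> (int^3^3) set" where
  "Xi_bar M = {N. det N = 1 \<and> N ** M = M ** N \<and>
     (\<forall>z::complex. poly (map_poly of_int (charpoly N)) z = 0 \<longrightarrow> z \<in> \<real> \<and> 0 < Re z)}"

definition face_orbit :: "int^3^3 \<Rightarrow> (real^3) set \<Rightarrow> (real^3) set set" where
  "face_orbit M F = {(\<lambda>x. map_matrix real_of_int N *v x) ` F | N. N \<in> Xi_bar M}"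

definition fundamental_domain :: "int^3^3 \<Rightarrow> (real^3) set \<Rightarrow> (real^3) set \<Rightarrow> bool" where
  "fundamental_domain M Q X \<longleftrightarrow>
     (\<exists>\<F> \<subseteq> sail_faces Q. X = \<Union>\<F> \<and>
        (\<forall>F \<in> sail_faces Q. \<exists>!G. G \<in> \<F> \<and> G \<in> face_orbit M F))"

definition A_mat :: "int \<Rightarrow> int \<Rightarrow> int^3^3" where
  "A_mat m n = vector [vector [0, 1, 0], vector [0, 0, 1], vector [1, -m, -n]]"

lemma charpoly_A_mat: "charpoly (A_mat m n) = [:-1, m, n, 1:]"
  by (simp add: charpoly_def A_mat_def det_3 mat_def)

lemma cf_operator_A_mat:
  fixes a b :: int
  assumes "0 \<le> a" "0 \<le> b" and m: "m = b - a - 1" and n: "n = (a + 2) * (b + 1)"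
  shows "cf_operator (A_mat m n)"
proof -
  have ab: "0 \<le> a * b" using assms by simp
  have pos1: "n + m > 0" and pos2: "n - m - 2 > 0"
    using assms(1,2) ab unfolding m n distrib_left distrib_right by linarith+
  have "det (A_mat m n) = 1"
    by (simp add: A_mat_def det_3)
  moreover have "card {x::real. poly (map_poly of_int (charpoly (A_mat m n))) x = 0} = 3"
  proof -
    define p :: "real poly" where "p = [:-1, of_int m, of_int n, 1:]"
    have p: "map_poly of_int (charpoly (A_mat m n)) = p"
      by (simp add: charpoly_A_mat p_def map_poly_pCons)
    have v0: "poly p 0 < 0" by (simp add: p_def)
    have v1: "poly p 1 > 0"
      using pos1 by (simp add: p_def flip: of_int_add)
    have v2: "poly p (-1) > 0"
    proof -
      have "poly p (-1) = of_int (n - m - 2)" by (simp add: p_def)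
      then show ?thesis using pos2 by simp
    qed
    define N where "N = - real_of_int (n + \<bar>m\<bar> + 2)"
    have npos: "n \<ge> 1" using pos1 pos2 by linarith
    have N1: "N < -1" using npos by (simp add: N_def)
    have v3: "poly p N < 0"
    proof -
      define t where "t = n + \<bar>m\<bar> + 2"
      have t: "t \<ge> 3" using npos by (simp add: t_def)
      have "poly p N = of_int (- 1 - m * t + n * t^2 - t^3)"
        by (simp add: p_def N_def t_def power2_eq_square power3_eq_cube algebra_simps)
      moreover have "- 1 - m * t + n * t^2 - t^3 = -1 - t * (m + t * (\<bar>m\<bar> + 2))"
        by (simp add: t_def power2_eq_square power3_eq_cube algebra_simps)
      moreover have "\<bar>m\<bar> + 2 \<le> t * (\<bar>m\<bar> + 2)" using t by (simp add: mult_le_cancel_right1)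
      then have "0 \<le> t * (m + t * (\<bar>m\<bar> + 2))" using t by (intro mult_nonneg_nonneg) linarith+
      ultimately show ?thesis by (smt (verit) of_int_less_0_iff)
    qed
    obtain x where x: "N < x" "x < -1" "poly p x = 0"
      using poly_IVT_pos[OF N1 v3 v2] by blast
    obtain y where y: "-1 < y" "y < 0" "poly p y = 0"
      using poly_IVT_neg[of "-1" 0 p] v2 v0 by auto
    obtain z where z: "0 < z" "z < 1" "poly p z = 0"
      using poly_IVT_pos[of 0 1 p] v1 v0 by auto
    have p0: "p \<noteq> 0" by (simp add: p_def)
    have "degree p = 3" by (simp add: p_def)
    then have "card {x. poly p x = 0} \<le> 3"
      using card_poly_roots_bound[OF p0] by simp
    moreover have "{x, y, z} \<subseteq> {x. poly p x = 0}" using x y z by auto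
    then have "card {x, y, z} \<le> card {x. poly p x = 0}"
      using poly_roots_finite[OF p0] by (intro card_mono)
    moreover have "card {x, y, z} = 3" using x y z by auto
    ultimately show ?thesis unfolding p by simp
  qed
  moreover have "irreducible (map_poly rat_of_int (charpoly (A_mat m n)))"
  proof -
    define p :: "rat poly" where "p = [:-1, of_int m, of_int n, 1:]"
    have p: "map_poly of_int (charpoly (A_mat m n)) = p"
      by (simp add: charpoly_A_mat p_def map_poly_pCons)
    have deg: "degree p = 3" by (simp add: p_def)
    have noroot: "poly p x \<noteq> 0" for x
    proof
      assume x: "poly p x = 0"
      have "algebraic_int x"
      proof (rule algebraic_int.intros)
        show "lead_coeff p = 1" by (simp add: p_def)
        show "\<forall>i. coeff p i \<in> \<int>"
          by (auto simp: p_def coeff_pCons split: nat.split)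
      qed (fact x)
      moreover have "x \<in> \<rat>"
        using Rats_of_rat[of x, where ?'a = rat] by simp
      ultimately have "x \<in> \<int>" by (rule rational_algebraic_int_is_int)
      then obtain k where k: "x = of_int k" by (elim Ints_cases)
      have "rat_of_int (-1 + k * (m + k * (n + k))) = 0"
        using x by (simp add: p_def k)
      then have eq: "k * (m + k * (n + k)) = 1" by (simp only: of_int_eq_0_iff)
      then have "k = 1 \<or> k = -1" using zmult_eq_1_iff by blast
      then show False using eq pos1 pos2 by auto
    qed
    have lin: False if pqr: "p = q * r" and q1: "degree q = 1" for q r
    proof -
      obtain c d where "q = [:c, d:]" "d \<noteq> 0"
        using degree1_coeffs[OF q1] by metis
      then have "poly q (- c / d) = 0" by simp
      then show False using noroot[of "- c / d"] pqr by simp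
    qed
    have "irreducible p"
    proof (rule irreducibleI)
      show p0: "p \<noteq> 0" using deg by auto
      show "\<not> p dvd 1" using deg is_unit_iff_degree[OF p0] by simp
      fix q r assume qr: "p = q * r"
      then have nz: "q \<noteq> 0" "r \<noteq> 0" using deg by auto
      have "degree q + degree r = 3" using deg qr nz by (simp add: degree_mult_eq)
      moreover have "degree q \<noteq> 1" using lin qr by blast
      moreover have "degree r \<noteq> 1" using lin[of r q] qr by (auto simp: mult.commute)
      ultimately have "degree q = 0 \<or> degree r = 0" by linarith
      then show "q dvd 1 \<or> r dvd 1" using nz by (auto simp: is_unit_iff_degree)
    qed
    then show ?thesis unfolding p .
  qed
  ultimately show ?thesis unfolding cf_operator_def by blast
qed

end

theory Submission
  imports Defs
begin

text \<open>
Sending the point \<open>(x, y, z)\<close> to \<open>x t + y (t\<^sup>2 - m t) + z\<close>, where \<open>1/t\<close> is an eigenvalue, turns the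
lattice into \<open>\<int>[t]\<close> and the action of the group into multiplication by units; the three
conjugates of this number are positive exactly on the orthant of \<open>B\<close>. With \<open>h = a + 2\<close> and
\<open>k = b + 1\<close> the equation for \<open>t\<close> reads \<open>t (t + h) (t - k) = 1\<close>, and \<open>B = 1\<close>, \<open>C = \<alpha>\<close>, \<open>A = \<beta>\<close>,
\<open>D = \<alpha> \<beta>\<close> for the totally positive units \<open>\<alpha> = t\<^sup>2\<close> and \<open>\<beta> = t + h\<close>, so that translates of the
triangles \<open>ABD\<close> and \<open>BDC\<close> are glued along their edges like a triangulated torus.

Let the height of a triangle be the linear functional with value \<open>1\<close> on its plane. Passing to the
neighbour across an edge changes the height by a positive multiple of the barycentric coordinate at
the opposite vertex. Hence a triangle whose height at \<open>x\<close> does not exceed those of its three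
neighbours has \<open>x\<close> in its cone. All heights are at least \<open>1\<close> on the lattice points, so both
triangles are faces; and at every point of the hull some translate has the smallest height, so
the cones over the translates cover the hull and the translates cover its boundary.
\<close>

no_notation fps_nth (infixl "$" 75)

section \<open>Faces of convex hulls\<close>

lemma face_of_convex_hull_eq:
  fixes S :: "'a::euclidean_space set"
  assumes F: "F face_of convex hull S"
  shows "F = convex hull (S \<inter> F)"
proof
  show "convex hull (S \<inter> F) \<subseteq> F"
    using face_of_imp_convex[OF F] by (simp add: hull_minimal)
  show "F \<subseteq> convex hull (S \<inter> F)"
  proof
    fix x assume x: "x \<in> F"
    then obtain T where T: "finite T" "T \<subseteq> S" "x \<in> convex hull T"
      using face_of_imp_subset[OF F] caratheodory[of S] by blast
    have "F \<inter> convex hull T face_of convex hull T"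
      using face_of_slice[OF F convex_convex_hull, of T] hull_mono[OF T(2), of convex]
      by (simp add: Int_absorb1)
    then obtain T' where T': "T' \<subseteq> T" "F \<inter> convex hull T = convex hull T'"
      using face_of_convex_hull_subset finite_imp_compact[OF T(1)] by metis
    then have "T' \<subseteq> S \<inter> F" using T(2) hull_subset[of T' convex] by blast
    then show "x \<in> convex hull (S \<inter> F)" using T(3) T'(2) x hull_mono by blast
  qed
qed

lemma convex_hull_min_level_face_of:
  fixes f :: "'a::euclidean_space \<Rightarrow> real"
  assumes "linear f" and ge: "\<And>x. x \<in> S \<Longrightarrow> c \<le> f x"
  shows "convex hull {x \<in> S. f x = c} face_of convex hull S"
proof -
  define w where "w = adjoint f 1"
  have f: "f x = w \<bullet> x" for x
    using adjoint_works[OF assms(1), of x 1] by (simp add: w_def inner_commute)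
  let ?F = "convex hull S \<inter> {x. w \<bullet> x = c}"
  have "convex hull S \<subseteq> {x. w \<bullet> x \<ge> c}"
    using ge convex_halfspace_ge by (intro hull_minimal) (auto simp: f)
  then have face: "?F face_of convex hull S"
    by (intro face_of_Int_supporting_hyperplane_ge) auto
  have "S \<inter> ?F = {x \<in> S. f x = c}" using hull_inc by (auto simp: f)
  then show ?thesis using face face_of_convex_hull_eq[OF face] by simp
qed

lemma supporting_functional_at_boundary:
  fixes S :: "'a::euclidean_space set"
  assumes "convex S" "x \<in> S" "x \<notin> interior S"
  obtains w where "w \<noteq> 0" "\<And>y. y \<in> S \<Longrightarrow> w \<bullet> x \<le> w \<bullet> y"
proof (cases "interior S = {}")
  case True
  then obtain w c where "w \<noteq> 0" "S \<subseteq> {x. w \<bullet> x = c}"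
    using empty_interior_subset_hyperplane[OF assms(1)] by blast
  then show ?thesis
    using that[of w] assms(2) by (metis (mono_tags) mem_Collect_eq order_refl subset_iff)
next
  case False
  then have "x \<notin> rel_interior S" using assms(3) by (simp add: rel_interior_nonempty_interior)
  then show ?thesis
    using supporting_hyperplane_rel_boundary[OF assms(1,2)] that by metis
qed

lemma convex_hull_3_scaled:
  fixes P Q R :: "'a::real_vector"
  assumes "0 \<le> p" "0 \<le> q" "0 \<le> r" and pos: "0 < p + q + r"
  obtains x where "x \<in> convex hull {P, Q, R}" "p *\<^sub>R P + q *\<^sub>R Q + r *\<^sub>R R = (p + q + r) *\<^sub>R x"
proof
  let ?s = "p + q + r"
  show "(p / ?s) *\<^sub>R P + (q / ?s) *\<^sub>R Q + (r / ?s) *\<^sub>R R \<in> convex hull {P, Q, R}"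
    unfolding convex_hull_3 using assms
    by (intro CollectI exI[of _ "p / ?s"] exI[of _ "q / ?s"] exI[of _ "r / ?s"])
      (simp flip: add_divide_distrib)
  show "p *\<^sub>R P + q *\<^sub>R Q + r *\<^sub>R R = ?s *\<^sub>R ((p / ?s) *\<^sub>R P + (q / ?s) *\<^sub>R Q + (r / ?s) *\<^sub>R R)"
    using pos by (simp add: scaleR_add_right)
qed

lemma rel_interior_convex_hull_eq_imp_eq:
  fixes V W :: "'a::euclidean_space set"
  assumes V: "\<not> affine_dependent V" and W: "\<not> affine_dependent W"
    and eq: "rel_interior (convex hull V) = rel_interior (convex hull W)"
  shows "V = W"
proof -
  have "convex hull X = closure (rel_interior (convex hull X))" if "\<not> affine_dependent X"
    for X :: "'a set"
    using aff_independent_finite[OF that]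
    by (simp add: convex_closure_rel_interior finite_imp_compact_convex_hull compact_imp_closed)
  then have "convex hull V = convex hull W" using V W eq by metis
  then show ?thesis
    using extreme_point_of_convex_hull_affine_independent[OF V]
      extreme_point_of_convex_hull_affine_independent[OF W] by auto
qed

section \<open>Minimal functionals on convex hulls\<close>

definition finite_below :: "real set \<Rightarrow> bool" where
  "finite_below X \<longleftrightarrow> (\<forall>K. finite (X \<inter> {..K}))"

lemma finite_below_subset_sum:
  fixes s t :: real
  assumes X: "finite_below X" "\<And>x. x \<in> X \<Longrightarrow> 0 \<le> x" and Y: "finite_below Y" "\<And>y. y \<in> Y \<Longrightarrow> 0 \<le> y"
    and st: "0 < s" "0 < t" and Z: "Z \<subseteq> (\<lambda>(x, y). s * x + t * y) ` (X \<times> Y)"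
  shows "finite_below Z"
  unfolding finite_below_def
proof
  fix K
  have "Z \<inter> {..K} \<subseteq> (\<lambda>(x, y). s * x + t * y) ` ((X \<inter> {..K / s}) \<times> (Y \<inter> {..K / t}))"
  proof
    fix z assume "z \<in> Z \<inter> {..K}"
    then obtain x y where z: "z = s * x + t * y" "x \<in> X" "y \<in> Y" "z \<le> K" using Z by auto
    then have "0 \<le> s * x" "0 \<le> t * y" using X(2) Y(2) st by simp_all
    then have "s * x \<le> K" "t * y \<le> K" using z by linarith+
    then have "x \<le> K / s" "y \<le> K / t" using st by (simp_all add: field_simps)
    then show "z \<in> (\<lambda>(x, y). s * x + t * y) ` ((X \<inter> {..K / s}) \<times> (Y \<inter> {..K / t}))" using z by auto
  qed
  then show "finite (Z \<inter> {..K})"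
    by (rule finite_subset) (use X(1) Y(1) in \<open>auto simp: finite_below_def\<close>)
qed

lemma finite_below_attains_min:
  assumes "finite_below X" "X \<noteq> {}"
  obtains x where "x \<in> X" "\<And>y. y \<in> X \<Longrightarrow> x \<le> y"
proof -
  obtain z where z: "z \<in> X" using assms(2) by blast
  let ?X = "X \<inter> {..z}"
  have fin: "finite ?X" "?X \<noteq> {}" using assms(1) z by (auto simp: finite_below_def)
  have "Min ?X \<le> y" if "y \<in> X" for y
    using Min_le[OF fin(1), of y] Min_le[OF fin(1), of z] that z by fastforce
  then show ?thesis using that Min_in[OF fin] by blast
qed

lemma convex_nonneg_finite_below:
  fixes \<Phi> :: "('a::real_vector \<Rightarrow> real) set"
  assumes lin: "\<And>f. f \<in> \<Phi> \<Longrightarrow> linear f"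
  shows "convex {x. (\<forall>f\<in>\<Phi>. 0 \<le> f x) \<and> finite_below ((\<lambda>f. f x) ` \<Phi>)}" (is "convex ?D")
proof (rule convexI)
  fix x y and s t :: real
  assume xy: "x \<in> ?D" "y \<in> ?D" and st: "0 \<le> s" "0 \<le> t" "s + t = 1"
  let ?z = "s *\<^sub>R x + t *\<^sub>R y"
  have comb: "f ?z = s * f x + t * f y" if "f \<in> \<Phi>" for f
    using lin[OF that] by (simp add: linear_add linear_scale)
  consider "s = 0" "t = 1" | "t = 0" "s = 1" | "0 < s" "0 < t" using st by fastforce
  then show "?z \<in> ?D"
  proof cases
    case 3
    let ?values = "\<lambda>x. (\<lambda>f. f x) ` \<Phi>"
    have comb_values: "?values ?z \<subseteq> (\<lambda>(p, q). s * p + t * q) ` (?values x \<times> ?values y)"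
    proof clarify
      fix f assume f: "f \<in> \<Phi>"
      show "f ?z \<in> (\<lambda>(p, q). s * p + t * q) ` (?values x \<times> ?values y)"
        by (rule image_eqI[of _ _ "(f x, f y)"]) (simp_all add: comb[OF f] f)
    qed
    have "finite_below (?values ?z)"
      by (rule finite_below_subset_sum[OF _ _ _ _ 3 comb_values]) (use xy in auto)
    moreover have "0 \<le> f ?z" if "f \<in> \<Phi>" for f
      using xy st that by (simp add: comb)
    ultimately show ?thesis by simp
  qed (use xy in auto)
qed

text \<open>Convex combinations inherit discreteness of the values of a family of linear
  functionals: this replaces any growth estimate for the units when a minimum is needed.\<close>

lemma convex_hull_attains_min_functional:
  fixes \<Phi> :: "('a::real_vector \<Rightarrow> real) set"
  assumes lin: "\<And>f. f \<in> \<Phi> \<Longrightarrow> linear f" and nonneg: "\<And>f x. f \<in> \<Phi> \<Longrightarrow> x \<in> S \<Longrightarrow> 0 \<le> f x"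
    and fin: "\<And>x. x \<in> S \<Longrightarrow> finite_below ((\<lambda>f. f x) ` \<Phi>)"
    and nonempty: "\<Phi> \<noteq> {}" and x: "x \<in> convex hull S"
  shows "\<exists>f\<in>\<Phi>. \<forall>g\<in>\<Phi>. f x \<le> g x"
proof -
  have "convex hull S \<subseteq> {x. (\<forall>f\<in>\<Phi>. 0 \<le> f x) \<and> finite_below ((\<lambda>f. f x) ` \<Phi>)}"
    using nonneg fin convex_nonneg_finite_below[OF lin] by (intro hull_minimal) auto
  then have "finite_below ((\<lambda>f. f x) ` \<Phi>)" using x by blast
  moreover have "(\<lambda>f. f x) ` \<Phi> \<noteq> {}" using nonempty by simp
  ultimately obtain r where r: "r \<in> (\<lambda>f. f x) ` \<Phi>" "\<And>y. y \<in> (\<lambda>f. f x) ` \<Phi> \<Longrightarrow> r \<le> y"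
    by (rule finite_below_attains_min) blast
  from r(1) obtain f where "f \<in> \<Phi>" "r = f x" by blast
  then show ?thesis using r(2) by blast
qed

section \<open>Integer matrices acting on real vectors\<close>

abbreviation act :: "int^'n^'n \<Rightarrow> real^'n \<Rightarrow> real^'n" where
  "act N x \<equiv> map_matrix real_of_int N *v x"

lemma act_mult: "act (M ** N) x = act M (act N x)"
proof -
  have "map_matrix real_of_int (M ** N) = map_matrix real_of_int M ** map_matrix real_of_int N"
    by (simp add: vec_eq_iff matrix_matrix_mult_def)
  then show ?thesis by (simp add: matrix_vector_mul_assoc)
qed

lemma act_mat: "act (mat c) x = of_int c *\<^sub>R x"
  by (simp add: vec_eq_iff mat_def matrix_vector_mult_def if_distrib[of real_of_int]
      if_distrib[of "\<lambda>y. y * _"] cong: if_cong)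

lemma act_add: "act (M + N) x = act M x + act N x"
  by (simp add: vec_eq_iff matrix_vector_mult_def sum.distrib distrib_right)

lemma act_diff: "act (M - N) x = act M x - act N x"
  by (simp add: vec_eq_iff matrix_vector_mult_def sum_subtractf left_diff_distrib)

lemma linear_act: "linear (act N)"
  by simp

lemma act_Ints: "(\<And>i. x $ i \<in> \<int>) \<Longrightarrow> act N x $ j \<in> \<int>"
  by (auto simp: matrix_vector_mult_def intro!: Ints_sum Ints_mult)

lemma det_1_inverse:
  fixes N :: "'a::comm_ring_1^3^3"
  assumes "det N = 1"
  obtains N' where "N ** N' = mat 1" "N' ** N = mat 1"
proof -
  define N' :: "'a^3^3" where "N' = vector
    [vector [N$2$2 * N$3$3 - N$2$3 * N$3$2, N$1$3 * N$3$2 - N$1$2 * N$3$3, N$1$2 * N$2$3 - N$1$3 * N$2$2],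
     vector [N$2$3 * N$3$1 - N$2$1 * N$3$3, N$1$1 * N$3$3 - N$1$3 * N$3$1, N$1$3 * N$2$1 - N$1$1 * N$2$3],
     vector [N$2$1 * N$3$2 - N$2$2 * N$3$1, N$1$2 * N$3$1 - N$1$1 * N$3$2, N$1$1 * N$2$2 - N$1$2 * N$2$1]]"
  have "(N ** N') $ i $ j = mat (det N) $ i $ j" "(N' ** N) $ i $ j = mat (det N) $ i $ j" for i j
    using exhaust_3[of i] exhaust_3[of j]
    by (auto simp: N'_def matrix_matrix_mult_def sum_3 mat_def det_3 algebra_simps)
  then have "N ** N' = mat (det N)" "N' ** N = mat (det N)" by (simp_all add: vec_eq_iff)
  then show ?thesis using assms that by simp
qed

lemma poly_charpoly:
  fixes z :: "'a::{comm_ring_1,ring_char_0}"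
  shows "poly (map_poly of_int (charpoly N)) z = det (mat z - map_matrix of_int N)"
proof -
  define ev where "ev p = poly (map_poly of_int p) z" for p
  have add: "ev (p + q) = ev p + ev q" and diff: "ev (p - q) = ev p - ev q" for p q
  proof -
    have "map_poly of_int (p + q) = map_poly of_int p + (map_poly of_int q :: 'a poly)"
      "map_poly of_int (p - q) = map_poly of_int p - (map_poly of_int q :: 'a poly)"
      by (auto simp: coeff_map_poly intro!: poly_eqI)
    then show "ev (p + q) = ev p + ev q" "ev (p - q) = ev p - ev q" by (simp_all add: ev_def)
  qed
  have smult: "ev (smult c p) = of_int c * ev p" for c p
    by (simp add: ev_def map_poly_smult)
  have pCons: "ev (pCons c p) = of_int c + z * ev p" for c p
    by (simp add: ev_def map_poly_pCons)
  have mult: "ev (p * q) = ev p * ev q" for p q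
    by (induction p) (simp_all add: add smult pCons algebra_simps, simp add: ev_def)
  have entry: "ev ((mat [:0, 1:] - map_matrix (\<lambda>x. [:x:]) N) $ i $ j)
      = (mat z - map_matrix of_int N) $ i $ j" for i j
    by (simp add: mat_def ev_def map_poly_pCons)
  show ?thesis
    unfolding charpoly_def det_3 ev_def[symmetric] by (simp only: add diff mult entry)
qed

lemma det_mat_diff_of_left_eigenvectors:
  fixes N P :: "'a::field^'n^'n"
  assumes eigen: "\<And>i. P $ i v* N = g i *s P $ i" and "det P \<noteq> 0"
  shows "det (mat z - N) = (\<Prod>i\<in>UNIV. z - g i)"
proof -
  have "P ** (mat z - N) = (\<chi> i. (z - g i) *s P $ i)"
  proof -
    have "(P ** mat z) $ i $ j = z * P $ i $ j" for i j
      by (simp add: matrix_matrix_mult_def mat_def if_distrib[of "\<lambda>y. _ * y"] mult.commute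
          cong: if_cong)
    moreover have "(P ** N) $ i $ j = g i * P $ i $ j" for i j
      using arg_cong[OF eigen[of i], of "\<lambda>v. v $ j"]
      by (simp add: matrix_matrix_mult_def vector_matrix_mult_def mult.commute)
    ultimately show ?thesis
      by (simp add: vec_eq_iff matrix_matrix_mult_def sum_subtractf algebra_simps)
  qed
  then have "det P * det (mat z - N) = (\<Prod>i\<in>UNIV. z - g i) * det P"
    using det_rows_mul[of "\<lambda>i. z - g i" "\<lambda>i. P $ i"] by (simp flip: det_mul add: vec_lambda_eta)
  then show ?thesis using \<open>det P \<noteq> 0\<close> by simp
qed

section \<open>The eigenfunctionals of the operator\<close>

lemma monic_cubic_vieta:
  fixes x y z p q r :: "'a::idom"
  assumes distinct: "x \<noteq> y" "x \<noteq> z" "y \<noteq> z"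
    and roots: "x^3 + p * x^2 + q * x + r = 0" "y^3 + p * y^2 + q * y + r = 0"
      "z^3 + p * z^2 + q * z + r = 0"
  shows "p = - (x + y + z)" and "q = x * y + x * z + y * z" and "r = - (x * y * z)"
proof -
  have "(x - y) * (x\<^sup>2 + x * y + y\<^sup>2 + p * (x + y) + q) = 0"
    "(x - z) * (x\<^sup>2 + x * z + z\<^sup>2 + p * (x + z) + q) = 0"
    using roots by algebra+
  then have quot: "x\<^sup>2 + x * y + y\<^sup>2 + p * (x + y) + q = 0"
    "x\<^sup>2 + x * z + z\<^sup>2 + p * (x + z) + q = 0"
    using distinct by simp_all
  then have "(y - z) * (x + y + z + p) = 0" by algebra
  then have "x + y + z + p = 0" using distinct by simp
  then show "p = - (x + y + z)" "q = x * y + x * z + y * z" "r = - (x * y * z)"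
    using quot(1) roots(1) by algebra+
qed

locale A_mat_spectrum =
  fixes m n :: int and t1 t2 t3 :: real
  assumes distinct: "t1 \<noteq> t2" "t1 \<noteq> t3" "t2 \<noteq> t3"
    and vieta: "of_int m = t1 + t2 + t3" "of_int n = - (t1 * t2 + t1 * t3 + t2 * t3)"
      "t1 * t2 * t3 = 1"
begin

abbreviation "M \<equiv> A_mat m n"

definition T :: "real set" where "T = {t1, t2, t3}"

definition emb :: "real \<Rightarrow> real^3 \<Rightarrow> real" where
  "emb t x = x $ 1 * t + x $ 2 * (t^2 - of_int m * t) + x $ 3"

definition B :: "real^3" where "B = vector [0, 0, 1]"

definition eigval :: "int^3^3 \<Rightarrow> real \<Rightarrow> real" where
  "eigval N t = emb t (act N B)"

definition eigvec :: "real \<Rightarrow> real^3" where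
  "eigvec t = vector [t^2, t, 1]"

lemma root: "t \<in> T \<Longrightarrow> t^3 = of_int m * t^2 + of_int n * t + 1"
  using vieta(3) unfolding vieta(1,2)
  by (auto simp: T_def algebra_simps power2_eq_square power3_eq_cube)

lemma root_nonzero: "t \<in> T \<Longrightarrow> t \<noteq> 0"
  using vieta(3) by (auto simp: T_def)

lemma linear_emb: "linear (emb t)"
  by (rule linearI) (simp_all add: emb_def algebra_simps)

lemma continuous_on_emb: "continuous_on S (emb t)"
  by (simp add: linear_continuous_on linear_conv_bounded_linear[symmetric] linear_emb)

lemma emb_B [simp]: "emb t B = 1"
  by (simp add: emb_def B_def)

lemma act_M: "act M x = vector [x $ 2, x $ 3, x $ 1 - of_int m * x $ 2 - of_int n * x $ 3]"
  by (simp add: A_mat_def vec_eq_iff forall_3 matrix_vector_mult_def sum_3)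

lemma emb_act_M:
  assumes "t \<in> T"
  shows "t * emb t (act M x) = emb t x"
proof -
  have "t * emb t (act M x) - emb t x = x $ 3 * (t^3 - of_int m * t^2 - of_int n * t - 1)"
    by (simp add: emb_def act_M algebra_simps power2_eq_square power3_eq_cube)
  then show ?thesis using root[OF assms] by simp
qed

lemma eq_0_if_emb_eq_0:
  assumes "\<And>t. t \<in> T \<Longrightarrow> emb t x = 0"
  shows "x = 0"
proof -
  define p q where "p = x $ 2" and "q = x $ 1 - of_int m * x $ 2"
  have poly: "p * t^2 + q * t + x $ 3 = 0" if "t \<in> T" for t
    using assms[OF that] by (simp add: emb_def p_def q_def algebra_simps)
  have "p * t1^2 + q * t1 + x $ 3 = 0" "p * t2^2 + q * t2 + x $ 3 = 0"
    "p * t3^2 + q * t3 + x $ 3 = 0"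
    by (simp_all add: poly T_def)
  then have "(t1 - t2) * (p * (t1 + t2) + q) = 0" "(t1 - t3) * (p * (t1 + t3) + q) = 0"
    by algebra+
  then have lin: "p * (t1 + t2) + q = 0" "p * (t1 + t3) + q = 0" using distinct by simp_all
  then have "(t2 - t3) * p = 0" by algebra
  then have "p = 0" using distinct by simp
  then show ?thesis using lin poly[of t1] by (simp add: T_def p_def q_def vec_eq_iff forall_3)
qed

lemma emb_eigenvector_eq_0:
  assumes "act M v = c *\<^sub>R v" "t \<in> T" "c * t \<noteq> 1"
  shows "emb t v = 0"
  using emb_act_M[OF assms(2), of v] assms(1,3)
  by (auto simp: linear_scale[OF linear_emb] mult.commute)

lemma act_M_eigvec:
  assumes "t \<in> T"
  shows "act M (eigvec t) = (1 / t) *\<^sub>R eigvec t"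
proof -
  have "t * (t^2 - of_int m * t - of_int n) = 1"
    using root[OF assms] by (simp add: algebra_simps power2_eq_square power3_eq_cube)
  then have "t^2 - of_int m * t - of_int n = 1 / t"
    using root_nonzero[OF assms] by (simp add: field_simps)
  then show ?thesis
    using root_nonzero[OF assms]
    by (simp add: act_M eigvec_def vec_eq_iff forall_3 power2_eq_square)
qed

lemma eigenvector_eigvec: "t \<in> T \<Longrightarrow> eigenvector M (eigvec t)"
  using act_M_eigvec by (auto simp: eigenvector_def eigvec_def vec_eq_iff forall_3)

lemma emb_eigvec_other:
  assumes "s \<in> T" "t \<in> T" "s \<noteq> t"
  shows "emb s (eigvec t) = 0"
  using act_M_eigvec[OF assms(2)] assms(1)
  by (rule emb_eigenvector_eq_0) (use assms(3) root_nonzero[OF assms(2)] in simp)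

lemma emb_eigvec_same:
  "emb t1 (eigvec t1) = t1 * (t1 - t2) * (t1 - t3)"
  "emb t2 (eigvec t2) = t2 * (t2 - t1) * (t2 - t3)"
  "emb t3 (eigvec t3) = t3 * (t3 - t1) * (t3 - t2)"
proof -
  have eq: "emb t (eigvec t) = 2 * t^3 - (t1 + t2 + t3) * t^2 + t1 * t2 * t3" for t
    unfolding vieta(3) vieta(1)[symmetric]
    by (simp add: emb_def eigvec_def algebra_simps power2_eq_square power3_eq_cube)
  show "emb t1 (eigvec t1) = t1 * (t1 - t2) * (t1 - t3)"
    and "emb t2 (eigvec t2) = t2 * (t2 - t1) * (t2 - t3)"
    and "emb t3 (eigvec t3) = t3 * (t3 - t1) * (t3 - t2)"
    unfolding eq by algebra+
qed

lemma eigvec_expansion: "x = (\<Sum>t\<in>T. (emb t x / emb t (eigvec t)) *\<^sub>R eigvec t)"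
proof -
  let ?y = "\<Sum>t\<in>T. (emb t x / emb t (eigvec t)) *\<^sub>R eigvec t"
  have "emb s ?y = emb s x" if s: "s \<in> T" for s
  proof -
    have "emb s ?y = (\<Sum>t\<in>T. emb t x / emb t (eigvec t) * emb s (eigvec t))"
      by (simp add: linear_sum[OF linear_emb] linear_scale[OF linear_emb])
    also have "\<dots> = (\<Sum>t\<in>T. if t = s then emb s x / emb s (eigvec s) * emb s (eigvec s) else 0)"
      using emb_eigvec_other[OF s] by (intro sum.cong) auto
    also have "\<dots> = emb s x / emb s (eigvec s) * emb s (eigvec s)"
      using s by (subst sum.delta) (simp_all add: T_def)
    also have "emb s (eigvec s) \<noteq> 0"
      using s distinct vieta(3) by (auto simp: T_def emb_eigvec_same)
    then have "emb s x / emb s (eigvec s) * emb s (eigvec s) = emb s x" by simp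
    finally show ?thesis .
  qed
  then have "x - ?y = 0"
    by (intro eq_0_if_emb_eq_0) (simp add: linear_diff[OF linear_emb])
  then show ?thesis by simp
qed

lemma eigenfunctional_eq:
  assumes lin: "linear w" and eigen: "\<And>x. t * w (act M x) = w x"
  shows "w x = w B * emb t x"
proof -
  let ?e = "\<lambda>i. axis i 1 :: real^3"
  have B: "?e 3 = B" by (simp add: B_def vec_eq_iff forall_3 axis_def)
  have "act M (?e 1) = B" "act M (?e 2) = ?e 1 - of_int m *\<^sub>R B"
    by (simp_all add: act_M B_def vec_eq_iff forall_3 axis_def)
  then have axis_1: "w (?e 1) = t * w B" and axis_2: "w (?e 2) = t * (w (?e 1) - of_int m * w B)"
    using eigen[of "?e 1"] eigen[of "?e 2"]
    by (simp_all add: linear_diff[OF lin] linear_scale[OF lin])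
  have "x = x $ 1 *\<^sub>R ?e 1 + x $ 2 *\<^sub>R ?e 2 + x $ 3 *\<^sub>R B"
    by (simp add: B_def vec_eq_iff forall_3 axis_def)
  then have "w x = w (x $ 1 *\<^sub>R ?e 1 + x $ 2 *\<^sub>R ?e 2 + x $ 3 *\<^sub>R B)" by simp
  also have "\<dots> = x $ 1 * w (?e 1) + x $ 2 * w (?e 2) + x $ 3 * w B"
    by (simp add: linear_add[OF lin] linear_scale[OF lin])
  finally show ?thesis
    unfolding axis_2 axis_1 by (simp add: emb_def algebra_simps power2_eq_square)
qed

lemma emb_act:
  assumes N: "N ** M = M ** N" and t: "t \<in> T"
  shows "emb t (act N x) = eigval N t * emb t x"
  unfolding eigval_def
proof (rule eigenfunctional_eq)
  show "linear (\<lambda>x. emb t (act N x))"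
    using linear_compose[OF linear_act linear_emb] by (simp add: o_def)
  show "t * emb t (act N (act M x)) = emb t (act N x)" for x
    using emb_act_M[OF t, of "act N x"] N by (metis act_mult)
qed

definition Minv :: "int^3^3" where
  "Minv = vector [vector [m, n, 1], vector [1, 0, 0], vector [0, 1, 0]]"

lemma Minv_inverse: "Minv ** M = mat 1" "M ** Minv = mat 1"
  by (simp_all add: Minv_def A_mat_def vec_eq_iff forall_3 matrix_matrix_mult_def sum_3 mat_def)

lemma act_Minv: "act Minv x = vector [of_int m * x $ 1 + of_int n * x $ 2 + x $ 3, x $ 1, x $ 2]"
  by (simp add: Minv_def vec_eq_iff forall_3 matrix_vector_mult_def sum_3)

section \<open>The positive unit group\<close>

lemma poly_charpoly_commuting:
  fixes z :: complex
  assumes N: "N ** M = M ** N"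
  shows "poly (map_poly of_int (charpoly N)) z = (\<Prod>t\<in>T. z - of_real (eigval N t))"
proof -
  define \<tau> :: "3 \<Rightarrow> real" where "\<tau> i = vector [t1, t2, t3] $ i" for i
  define P :: "complex^3^3" where "P = (\<chi> i j. of_real (emb (\<tau> i) (axis j 1)))"
  have \<tau>: "\<tau> 1 = t1" "\<tau> 2 = t2" "\<tau> 3 = t3" by (simp_all add: \<tau>_def)
  have \<tau>_T: "\<tau> i \<in> T" for i using exhaust_3[of i] \<tau> by (auto simp: T_def)
  have "P $ i v* map_matrix of_int N = of_real (eigval N (\<tau> i)) *s P $ i" for i
  proof -
    have "(\<Sum>k\<in>UNIV. emb (\<tau> i) (axis k 1) * of_int (N $ k $ j))
        = eigval N (\<tau> i) * emb (\<tau> i) (axis j 1)" for j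
    proof -
      have "act N (axis j 1) = (\<Sum>k\<in>UNIV. of_int (N $ k $ j) *\<^sub>R axis k 1)"
        using exhaust_3[of j]
        by (auto simp: vec_eq_iff forall_3 sum_3 axis_def matrix_vector_mult_def)
      then show ?thesis
        using emb_act[OF N \<tau>_T, of i "axis j 1"]
        by (simp add: linear_sum[OF linear_emb] linear_scale[OF linear_emb] mult.commute)
    qed
    then have "complex_of_real (\<Sum>k\<in>UNIV. emb (\<tau> i) (axis k 1) * of_int (N $ k $ j))
        = of_real (eigval N (\<tau> i) * emb (\<tau> i) (axis j 1))" for j
      by (simp only:)
    then show ?thesis
      by (simp add: P_def vec_eq_iff vector_matrix_mult_def mult.commute)
  qed
  moreover have "det P \<noteq> 0"
  proof -
    have "det P = of_real ((t1 - t2) * (t1 - t3) * (t3 - t2))"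
      by (simp add: P_def det_3 emb_def \<tau> axis_def algebra_simps power2_eq_square)
    then show ?thesis using distinct by simp
  qed
  ultimately have "det (mat z - map_matrix of_int N) = (\<Prod>i\<in>UNIV. z - of_real (eigval N (\<tau> i)))"
    by (rule det_mat_diff_of_left_eigenvectors)
  also have "\<dots> = (\<Prod>t\<in>T. z - of_real (eigval N t))"
    unfolding UNIV_3 using distinct by (simp add: T_def \<tau>)
  finally show ?thesis by (simp add: poly_charpoly)
qed

lemma Xi_bar_iff:
  "N \<in> Xi_bar M \<longleftrightarrow> det N = 1 \<and> N ** M = M ** N \<and> (\<forall>t\<in>T. 0 < eigval N t)"
proof -
  have "(\<forall>z::complex. poly (map_poly of_int (charpoly N)) z = 0 \<longrightarrow> z \<in> \<real> \<and> 0 < Re z)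
      \<longleftrightarrow> (\<forall>t\<in>T. 0 < eigval N t)" if N: "N ** M = M ** N"
  proof -
    have "poly (map_poly of_int (charpoly N)) z = 0 \<longleftrightarrow> (\<exists>t\<in>T. z = of_real (eigval N t))"
      for z :: complex
      unfolding poly_charpoly_commuting[OF N] by (simp add: T_def)
    then show ?thesis by auto
  qed
  then show ?thesis by (auto simp: Xi_bar_def)
qed

lemma emb_act_Xi: "N \<in> Xi_bar M \<Longrightarrow> t \<in> T \<Longrightarrow> emb t (act N x) = eigval N t * emb t x"
  by (simp add: emb_act Xi_bar_iff)

lemma eigval_pos: "N \<in> Xi_bar M \<Longrightarrow> t \<in> T \<Longrightarrow> 0 < eigval N t"
  by (simp add: Xi_bar_iff)

lemma Xi_bar_one: "mat 1 \<in> Xi_bar M"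
  by (simp add: Xi_bar_iff eigval_def act_mat)

lemma Xi_bar_mult:
  assumes N: "N \<in> Xi_bar M" and K: "K \<in> Xi_bar M"
  shows "N ** K \<in> Xi_bar M"
proof -
  have "(N ** K) ** M = M ** (N ** K)"
    using N K unfolding Xi_bar_iff by (metis matrix_mul_assoc)
  moreover have "eigval (N ** K) t = eigval N t * eigval K t" if "t \<in> T" for t
    using emb_act_Xi[OF N that, of "act K B"] by (simp add: eigval_def act_mult)
  ultimately show ?thesis
    using N K by (simp add: Xi_bar_iff det_mul)
qed

lemma Xi_bar_inverse:
  assumes N: "N \<in> Xi_bar M"
  obtains N' where "N' \<in> Xi_bar M" "N ** N' = mat 1" "N' ** N = mat 1"
proof -
  have "det N = 1" and comm: "N ** M = M ** N" using N by (simp_all add: Xi_bar_iff)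
  then obtain N' where N': "N ** N' = mat 1" "N' ** N = mat 1" by (metis det_1_inverse)
  have "N' ** M = N' ** M ** (N ** N')" by (simp add: N')
  also have "\<dots> = N' ** (N ** M) ** N'" by (simp add: comm matrix_mul_assoc)
  also have "\<dots> = M ** N'" by (simp add: N' matrix_mul_assoc)
  finally have "N' ** M = M ** N'" .
  moreover have "det N' = 1" using det_mul[of N N'] N'(1) \<open>det N = 1\<close> by simp
  moreover have "0 < eigval N' t" if t: "t \<in> T" for t
  proof -
    have "eigval N t * eigval N' t = 1"
      using emb_act_Xi[OF N t, of "act N' B"]
      by (simp add: act_mult[symmetric] N' act_mat eigval_def[of N'])
    then show ?thesis using eigval_pos[OF N t] by (metis zero_less_mult_pos zero_less_one)
  qed
  ultimately have "N' \<in> Xi_bar M" unfolding Xi_bar_iff by blast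
  then show ?thesis using that N' by blast
qed

lemma Xi_bar_right_inverse:
  assumes N: "N \<in> Xi_bar M" and K: "N ** K = mat 1"
  shows "K \<in> Xi_bar M"
proof -
  obtain N' where N': "N' \<in> Xi_bar M" "N' ** N = mat 1" using Xi_bar_inverse[OF N] by metis
  have "K = (N' ** N) ** K" using N' by simp
  also have "\<dots> = N'" using K by (simp add: matrix_mul_assoc[symmetric])
  finally show ?thesis using N' by simp
qed

lemma inj_act:
  assumes "N \<in> Xi_bar M"
  shows "inj (act N)"
proof -
  obtain N' where "N' ** N = mat 1" using Xi_bar_inverse[OF assms] by metis
  then have "act N' (act N x) = x" for x by (simp add: act_mult[symmetric] act_mat)
  then show ?thesis by (rule inj_on_inverseI)
qed

lemma image_act_eq:
  assumes sub: "\<And>K. K \<in> Xi_bar M \<Longrightarrow> act K ` S \<subseteq> S" and N: "N \<in> Xi_bar M"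
  shows "act N ` S = S"
proof
  obtain N' where N': "N' \<in> Xi_bar M" "N ** N' = mat 1" using Xi_bar_inverse[OF N] by metis
  show "S \<subseteq> act N ` S"
  proof
    fix x assume "x \<in> S"
    then have "act N' x \<in> S" using sub[OF N'(1)] by blast
    moreover have "x = act N (act N' x)" using N'(2) by (simp add: act_mult[symmetric] act_mat)
    ultimately show "x \<in> act N ` S" by (rule rev_image_eqI)
  qed
qed (rule sub[OF N])

section \<open>The orthant and its sail\<close>

definition pos_orthant :: "(real^3) set" where "pos_orthant = {x. \<forall>t\<in>T. 0 < emb t x}"

definition orthant_points :: "(real^3) set" where
  "orthant_points = integer_points \<inter> closure pos_orthant - {0}"

abbreviation "interior_points \<equiv> pos_orthant \<inter> orthant_points"

abbreviation "H \<equiv> sail_hull pos_orthant"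

lemma B_in_pos_orthant: "B \<in> pos_orthant"
  by (simp add: pos_orthant_def)

lemma convex_pos_orthant: "convex pos_orthant"
proof -
  have "pos_orthant = (\<Inter>t\<in>T. emb t -` {0<..})" by (auto simp: pos_orthant_def)
  then show ?thesis
    by (simp only:) (intro convex_INT convex_linear_vimage linear_emb convex_real_interval)
qed

lemma closure_pos_orthant: "closure pos_orthant = {x. \<forall>t\<in>T. 0 \<le> emb t x}"
proof
  have "closed {x. \<forall>t\<in>T. 0 \<le> emb t x}"
    by (auto simp: T_def intro!: closed_Collect_conj closed_Collect_le continuous_on_emb)
  then show "closure pos_orthant \<subseteq> {x. \<forall>t\<in>T. 0 \<le> emb t x}"
    by (intro closure_minimal) (auto simp: pos_orthant_def less_imp_le)
  show "{x. \<forall>t\<in>T. 0 \<le> emb t x} \<subseteq> closure pos_orthant"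
  proof
    fix x assume x: "x \<in> {x. \<forall>t\<in>T. 0 \<le> emb t x}"
    have "(\<lambda>k. x + inverse (of_nat (Suc k)) *\<^sub>R B) \<longlonglongrightarrow> x + 0 *\<^sub>R B"
      by (intro tendsto_intros LIMSEQ_inverse_real_of_nat)
    moreover have "x + inverse (of_nat (Suc k)) *\<^sub>R B \<in> pos_orthant" for k
      using x
      by (auto simp: pos_orthant_def linear_add[OF linear_emb] linear_scale[OF linear_emb]
          add_nonneg_pos)
    ultimately show "x \<in> closure pos_orthant"
      unfolding closure_sequential
      by (intro exI[of _ "\<lambda>k. x + inverse (of_nat (Suc k)) *\<^sub>R B"]) simp
  qed
qed

lemma emb_eq_0_imp_in_eigenplane:
  assumes s: "s \<in> T" and "emb s x = 0"
  shows "x \<in> \<Union>(eigenplanes M)"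
proof -
  obtain p q where pq: "T = {s, p, q}" "s \<noteq> p" "s \<noteq> q" "p \<noteq> q"
    using s distinct by (auto simp: T_def)
  let ?c = "\<lambda>t. emb t x / emb t (eigvec t)"
  have "x = ?c p *\<^sub>R eigvec p + ?c q *\<^sub>R eigvec q"
    using eigvec_expansion[of x] pq assms(2) by simp
  moreover have "?c p *\<^sub>R eigvec p + ?c q *\<^sub>R eigvec q \<in> span {eigvec p, eigvec q}"
    by (intro span_add span_scale span_base) simp_all
  moreover have "eigvec q \<notin> span {eigvec p}"
    using pq(4) by (auto simp: span_singleton eigvec_def vec_eq_iff forall_3)
  then have "span {eigvec p, eigvec q} \<in> eigenplanes M"
    using eigenvector_eigvec[of p] eigenvector_eigvec[of q] pq(1) unfolding eigenplanes_def by blast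
  ultimately show ?thesis by (metis UnionI)
qed

lemma Union_eigenplanes: "\<Union>(eigenplanes M) = {x. \<exists>t\<in>T. emb t x = 0}"
proof
  show "\<Union>(eigenplanes M) \<subseteq> {x. \<exists>t\<in>T. emb t x = 0}"
  proof clarify
    fix P x assume "P \<in> eigenplanes M" and x: "x \<in> P"
    then obtain v w where P: "P = span {v, w}" and v: "eigenvector M v" and w: "eigenvector M w"
      unfolding eigenplanes_def by blast
    obtain c d where c: "act M v = c *\<^sub>R v" and d: "act M w = d *\<^sub>R w"
      using v w by (auto simp: eigenvector_def)
    obtain t where t: "t \<in> T" "c * t \<noteq> 1" "d * t \<noteq> 1"
    proof -
      have "t = t'" if "e * t = 1" "e * t' = 1" for e t t' :: real
        using that by (metis mult_cancel_left mult_zero_left zero_neq_one)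
      then show ?thesis using that distinct unfolding T_def by (metis insertCI)
    qed
    then have "emb t v = 0" "emb t w = 0" using c d emb_eigenvector_eq_0 by blast+
    then have "emb t x = 0"
      using x linear_eq_0_on_span[OF linear_emb, of "{v, w}" t x] unfolding P by blast
    then show "\<exists>t\<in>T. emb t x = 0" using t(1) by blast
  qed
qed (use emb_eq_0_imp_in_eigenplane in blast)

lemma orthant_at_B: "orthant_at M B = pos_orthant"
proof
  show "orthant_at M B \<subseteq> pos_orthant"
  proof
    fix y assume "y \<in> orthant_at M B"
    then obtain S where S: "connected S" "S \<subseteq> - {x. \<exists>t\<in>T. emb t x = 0}" "B \<in> S" "y \<in> S"
      unfolding orthant_at_def Union_eigenplanes connected_component_def by blast
    have "0 < emb t y" if t: "t \<in> T" for t
    proof (rule ccontr)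
      assume "\<not> 0 < emb t y"
      moreover have "connected (emb t ` S)"
        using S(1) continuous_on_emb by (rule connected_continuous_image[rotated])
      then have "{emb t y..emb t B} \<subseteq> emb t ` S"
        using imageI[OF S(4), of "emb t"] imageI[OF S(3), of "emb t"]
        by (rule connected_contains_Icc)
      ultimately have "0 \<in> emb t ` S" by auto
      then show False using S(2) t by force
    qed
    then show "y \<in> pos_orthant" by (simp add: pos_orthant_def)
  qed
  show "pos_orthant \<subseteq> orthant_at M B"
    unfolding orthant_at_def Union_eigenplanes
    using B_in_pos_orthant convex_connected[OF convex_pos_orthant]
    by (rule connected_component_maximal) (auto simp: pos_orthant_def)
qed

lemma H_eq_convex_hull: "H = convex hull orthant_points"
  by (simp add: sail_hull_def orthant_points_def)

lemma convex_H: "convex H"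
  by (simp add: H_eq_convex_hull)

lemma orthant_points_in_H: "x \<in> orthant_points \<Longrightarrow> x \<in> H"
  by (simp add: H_eq_convex_hull hull_inc)

lemma orthant_points_iff: "x \<in> orthant_points \<longleftrightarrow> (\<forall>i. x $ i \<in> \<int>) \<and> (\<forall>t\<in>T. 0 \<le> emb t x) \<and> x \<noteq> 0"
  by (auto simp: orthant_points_def closure_pos_orthant integer_points_def)

lemma interior_points_iff: "x \<in> interior_points \<longleftrightarrow> (\<forall>i. x $ i \<in> \<int>) \<and> (\<forall>t\<in>T. 0 < emb t x)"
proof -
  have "0 \<notin> pos_orthant" using linear_0[OF linear_emb] by (simp add: pos_orthant_def T_def)
  then show ?thesis by (auto simp: orthant_points_iff pos_orthant_def less_imp_le)
qed

lemma act_interior_points: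
  assumes N: "N \<in> Xi_bar M" and x: "x \<in> interior_points"
  shows "act N x \<in> interior_points"
  using x eigval_pos[OF N] unfolding interior_points_iff by (simp add: emb_act_Xi[OF N] act_Ints)

lemma act_orthant_points:
  assumes "N \<in> Xi_bar M"
  shows "act N ` orthant_points = orthant_points"
proof (rule image_act_eq[OF _ assms], clarify)
  fix K x assume K: "K \<in> Xi_bar M" and x: "x \<in> orthant_points"
  have "act K x \<noteq> 0"
    using inj_act[OF K] x linear_injective_0[OF linear_act, of K] by (auto simp: orthant_points_iff)
  moreover have "0 \<le> emb t (act K x)" if "t \<in> T" for t
    using x eigval_pos[OF K that] that by (simp add: emb_act_Xi[OF K that] orthant_points_iff)
  ultimately show "act K x \<in> orthant_points" using x by (simp add: orthant_points_iff act_Ints)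
qed

lemma act_H: "N \<in> Xi_bar M \<Longrightarrow> act N ` H = H"
  by (simp add: H_eq_convex_hull convex_hull_linear_image[OF linear_act] act_orthant_points)

lemma scaleR_orthant_points: "x \<in> orthant_points \<Longrightarrow> 0 < k \<Longrightarrow> real k *\<^sub>R x \<in> orthant_points"
  by (auto simp: orthant_points_iff linear_scale[OF linear_emb])

lemma pos_orthant_absorbs_translation:
  assumes x: "x \<in> pos_orthant"
  obtains k :: nat where "real k *\<^sub>R x + y \<in> pos_orthant"
proof -
  have "\<exists>k::nat. - emb t y < real k * emb t x" if "t \<in> T" for t
    using reals_Archimedean3[of "emb t x"] x that by (auto simp: pos_orthant_def)
  then obtain f :: "real \<Rightarrow> nat" where f: "\<And>t. t \<in> T \<Longrightarrow> - emb t y < real (f t) * emb t x"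
    by metis
  define k where "k = sum f T"
  have "0 < emb t (real k *\<^sub>R x + y)" if t: "t \<in> T" for t
  proof -
    have "f t \<le> k" unfolding k_def using t by (intro member_le_sum) (simp_all add: T_def)
    then have "real (f t) * emb t x \<le> real k * emb t x"
      using x t by (intro mult_right_mono) (auto simp: pos_orthant_def less_imp_le)
    then show ?thesis
      using f[OF t] by (simp add: linear_add[OF linear_emb] linear_scale[OF linear_emb])
  qed
  then show ?thesis using that[of k] by (simp add: pos_orthant_def)
qed

lemma inner_nonneg_on_orthant_points:
  assumes w: "\<And>y. y \<in> H \<Longrightarrow> c \<le> w \<bullet> y" and x: "x \<in> orthant_points"
  shows "0 \<le> w \<bullet> x"
proof (rule ccontr)
  assume neg: "\<not> 0 \<le> w \<bullet> x"
  then have "0 < - (w \<bullet> x)" by simp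
  from reals_Archimedean3[OF this] obtain k :: nat where k: "- c < real k * (- (w \<bullet> x))" by blast
  have "real k * (- (w \<bullet> x)) \<le> real (Suc k) * (- (w \<bullet> x))"
    using neg by (intro mult_right_mono) auto
  moreover have "c \<le> w \<bullet> (real (Suc k) *\<^sub>R x)"
    using scaleR_orthant_points[OF x, of "Suc k"] by (intro w orthant_points_in_H) simp
  ultimately show False using k by simp
qed

lemma inner_pos_on_interior_points:
  assumes w: "\<And>y. y \<in> H \<Longrightarrow> c \<le> w \<bullet> y" and "w \<noteq> 0" and x: "x \<in> interior_points"
  shows "0 < w \<bullet> x"
proof (rule ccontr)
  assume "\<not> 0 < w \<bullet> x"
  then have wx: "w \<bullet> x = 0" using inner_nonneg_on_orthant_points[OF w, of x] x by force
  have nonneg: "0 \<le> w \<bullet> v" if v: "\<And>i. v $ i \<in> \<int>" for v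
  proof -
    obtain k :: nat where "real k *\<^sub>R x + v \<in> pos_orthant" using pos_orthant_absorbs_translation x
      by blast
    then have "real k *\<^sub>R x + v \<in> interior_points"
      using v x unfolding interior_points_iff by (simp add: pos_orthant_def)
    then have "0 \<le> w \<bullet> (real k *\<^sub>R x + v)" using inner_nonneg_on_orthant_points[OF w] by blast
    then show ?thesis using wx by (simp add: inner_add_right)
  qed
  have "w \<bullet> axis i 1 = 0" for i
  proof -
    have "0 \<le> w \<bullet> axis i 1" "0 \<le> w \<bullet> (- axis i 1)" by (intro nonneg; simp add: axis_def)+
    then show ?thesis by simp
  qed
  then show False using \<open>w \<noteq> 0\<close> by (simp add: inner_axis vec_eq_iff)
qed

lemma scaleR_in_interior_H:
  assumes V: "V \<subseteq> interior_points" and q: "q \<in> convex hull V" and s: "1 < s" and y: "s *\<^sub>R q \<in> H"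
  shows "s *\<^sub>R q \<in> interior H"
proof (rule ccontr)
  assume "s *\<^sub>R q \<notin> interior H"
  then obtain w where w: "w \<noteq> 0" "\<And>y. y \<in> H \<Longrightarrow> w \<bullet> (s *\<^sub>R q) \<le> w \<bullet> y"
    using supporting_functional_at_boundary[OF convex_H y] by metis
  have "V \<subseteq> {x. 0 < w \<bullet> x}"
    using inner_pos_on_interior_points[OF w(2,1)] V by blast
  then have "convex hull V \<subseteq> {x. 0 < w \<bullet> x}" by (intro hull_minimal convex_halfspace_gt)
  then have "0 < w \<bullet> q" using q by blast
  then have "w \<bullet> q < s * (w \<bullet> q)" using s by simp
  moreover have "q \<in> H"
    using q V hull_mono[of V orthant_points convex] by (auto simp: H_eq_convex_hull)
  then have "s * (w \<bullet> q) \<le> w \<bullet> q" using w(2) by simp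
  ultimately show False by simp
qed

end

section \<open>The two-parameter family\<close>

locale sail_family = A_mat_spectrum +
  fixes a b :: int
  assumes a_nonneg: "0 \<le> a" and b_nonneg: "0 \<le> b"
    and m_eq: "m = b - a - 1" and n_eq: "n = (a + 2) * (b + 1)"
    and t1_bounds: "- of_int (a + 2) < t1" "t1 < -1"
    and t2_bounds: "-1 < t2" "t2 < 0" and t3_bound: "of_int (b + 1) < t3"
begin

definition h :: real where "h = of_int (a + 2)"
definition k :: real where "k = of_int (b + 1)"

definition A :: "real^3" where "A = vector [1, 0, of_int (a + 2)]"
definition C :: "real^3" where "C = vector [of_int (b - a - 1), 1, 0]"
definition D :: "real^3" where "D = vector [of_int ((b + 1)^2), of_int (b + 1), 1]"

lemmas vertex_defs = A_def B_def C_def D_def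

lemma h_ge_2: "2 \<le> h" and k_ge_1: "1 \<le> k"
  using a_nonneg b_nonneg by (simp_all add: h_def k_def)

lemma of_int_params:
  "real_of_int m = k - h" "real_of_int n = h * k"
  by (simp_all add: h_def k_def m_eq n_eq)

lemma vertices_hk: "A = vector [1, 0, h]" "C = vector [k - h, 1, 0]" "D = vector [k^2, k, 1]"
  by (simp_all add: vertex_defs h_def k_def)

lemma unit_relation:
  assumes "t \<in> T"
  shows "t * (t + h) * (t - k) = 1"
  using root[OF assms] unfolding of_int_params by algebra

definition alpha :: "int^3^3" where "alpha = Minv ** Minv"
definition alpha_inv :: "int^3^3" where "alpha_inv = M ** M"
definition beta :: "int^3^3" where "beta = Minv + mat (a + 2)"
definition beta_inv :: "int^3^3" where "beta_inv = Minv ** (Minv - mat (b + 1))"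

lemma act_units:
  "act alpha x = act Minv (act Minv x)" "act alpha_inv x = act M (act M x)"
  "act beta x = act Minv x + h *\<^sub>R x" "act beta_inv x = act Minv (act Minv x - k *\<^sub>R x)"
  by (simp_all only: alpha_def alpha_inv_def beta_def beta_inv_def
      act_mult act_add act_diff act_mat h_def k_def)

lemma unit_inverses: "alpha ** alpha_inv = mat 1" "beta ** beta_inv = mat 1"
proof -
  have "alpha ** alpha_inv = Minv ** (Minv ** M) ** M"
    by (simp add: alpha_def alpha_inv_def matrix_mul_assoc)
  then show "alpha ** alpha_inv = mat 1" by (simp add: Minv_inverse)
  show "beta ** beta_inv = mat 1"
    unfolding beta_def beta_inv_def Minv_def
    by (simp add: vec_eq_iff forall_3 matrix_matrix_mult_def sum_3 mat_def m_eq n_eq algebra_simps)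
qed

lemma unit_images: "act alpha B = C" "act beta B = A" "act alpha A = D" "act beta C = D"
  unfolding act_units act_Minv of_int_params vertices_hk B_def
  by (simp_all add: vec_eq_iff forall_3 algebra_simps power2_eq_square)

lemma unit_inverse_images: "act alpha_inv C = B" "act alpha_inv D = A"
  unfolding act_units act_M of_int_params vertices_hk B_def
  by (simp_all add: vec_eq_iff forall_3 algebra_simps power2_eq_square)

lemma plus_h_pos: "t \<in> T \<Longrightarrow> 0 < t + h"
  using t1_bounds t2_bounds t3_bound a_nonneg b_nonneg by (auto simp: T_def h_def)

lemma emb_A: "t \<in> T \<Longrightarrow> emb t A = t + h" and emb_C: "t \<in> T \<Longrightarrow> emb t C = t^2"
  by (simp_all add: emb_def vertices_hk of_int_params algebra_simps power2_eq_square)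

lemma alpha_Xi: "alpha \<in> Xi_bar M"
proof -
  have "det Minv = 1" by (simp add: Minv_def det_3)
  moreover have "alpha ** M = M ** alpha"
    unfolding alpha_def by (metis Minv_inverse matrix_mul_assoc matrix_mul_lid matrix_mul_rid)
  moreover have "0 < eigval alpha t" if "t \<in> T" for t
    using root_nonzero[OF that] by (simp add: eigval_def unit_images emb_C that)
  ultimately show ?thesis unfolding Xi_bar_iff by (simp add: alpha_def det_mul)
qed

lemma beta_Xi: "beta \<in> Xi_bar M"
proof -
  have "det beta = 1"
    unfolding beta_def Minv_def by (simp add: det_3 mat_def m_eq n_eq algebra_simps)
  moreover have "beta ** M = M ** beta"
    by (simp add: beta_def Minv_def A_mat_def vec_eq_iff forall_3 matrix_matrix_mult_def sum_3
        mat_def algebra_simps)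
  moreover have "0 < eigval beta t" if "t \<in> T" for t
    using plus_h_pos[OF that] by (simp add: eigval_def unit_images emb_A that)
  ultimately show ?thesis unfolding Xi_bar_iff by blast
qed

lemmas alpha_inv_Xi = Xi_bar_right_inverse[OF alpha_Xi unit_inverses(1)]
lemmas beta_inv_Xi = Xi_bar_right_inverse[OF beta_Xi unit_inverses(2)]

lemma vertices_interior_points:
  "A \<in> interior_points" "B \<in> interior_points" "C \<in> interior_points" "D \<in> interior_points"
proof -
  show B: "B \<in> interior_points"
    unfolding interior_points_iff by (simp add: forall_3) (simp add: B_def)
  show A: "A \<in> interior_points" using act_interior_points[OF beta_Xi B] by (simp only: unit_images)
  show "C \<in> interior_points" using act_interior_points[OF alpha_Xi B] by (simp only: unit_images)
  show "D \<in> interior_points" using act_interior_points[OF alpha_Xi A] by (simp only: unit_images)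
qed

section \<open>The two triangles and their heights\<close>

definition slant :: "real^3 \<Rightarrow> real" where
  "slant x = x $ 1 - k * x $ 2"

definition height_ABD :: "real^3 \<Rightarrow> real" where
  "height_ABD x = x $ 3 - (h - 1) * slant x"

definition height_BDC :: "real^3 \<Rightarrow> real" where
  "height_BDC x = x $ 3 - slant x / h"

lemma h_times_height_BDC: "h * height_BDC x = h * x $ 3 - slant x"
  using h_ge_2 by (simp add: height_BDC_def right_diff_distrib)

lemma linear_height: "linear height_ABD" "linear height_BDC"
  by (auto intro!: linearI simp: height_ABD_def height_BDC_def slant_def algebra_simps
      add_divide_distrib diff_divide_distrib)

lemma height_vertices:
  "height_ABD A = 1" "height_ABD B = 1" "height_ABD D = 1"
  "height_BDC B = 1" "height_BDC D = 1" "height_BDC C = 1"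
  using h_ge_2 unfolding height_ABD_def height_BDC_def slant_def vertices_hk B_def
  by (simp_all add: power2_eq_square)

lemma ABD_coordinates:
  "x = slant x *\<^sub>R A + (x $ 3 - h * slant x - x $ 2 / k) *\<^sub>R B + (x $ 2 / k) *\<^sub>R D"
  using k_ge_1
  by (simp add: vec_eq_iff forall_3 vertices_hk B_def slant_def power2_eq_square mult.commute)

lemma BDC_coordinates:
  "x = (x $ 3 - (x $ 2 + slant x / h) / k) *\<^sub>R B + ((x $ 2 + slant x / h) / k) *\<^sub>R D
    + (- slant x / h) *\<^sub>R C"
proof -
  define c where "c = slant x / h"
  have "x $ 1 = k * x $ 2 + h * c" using h_ge_2 by (simp add: c_def slant_def)
  then show ?thesis
    unfolding minus_divide_left[symmetric] c_def[symmetric] using k_ge_1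
    by (simp add: vec_eq_iff forall_3 vertices_hk B_def power2_eq_square field_simps)
qed

lemma Minv_slant_coordinates:
  "slant (act Minv x) = x $ 3 - h * slant x" "act Minv x $ 2 = slant x + k * x $ 2"
  "act Minv x $ 3 = x $ 2"
  by (simp_all add: act_Minv slant_def of_int_params algebra_simps)

lemma M_slant_coordinates:
  "slant (act M x) = x $ 2 - k * x $ 3" "act M x $ 2 = x $ 3"
  "act M x $ 3 = slant x + h * (x $ 2 - k * x $ 3)"
  by (simp_all add: act_M slant_def of_int_params algebra_simps)

lemma linear_slant: "linear slant"
  by (rule linearI) (simp_all add: slant_def algebra_simps)

text \<open>The right-hand sides are positive multiples of the barycentric coordinates at the vertex
  opposite to the common edge of the two triangles.\<close>

lemma neighbours_ABD:
  "h * (height_BDC x - height_ABD x) = (h * (h - 1) - 1) * slant x"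
  "h * (height_BDC (act alpha x) - height_ABD x) = (h * k - 1) * x $ 2"
  "h * (height_BDC (act beta_inv x) - height_ABD x) = k * (x $ 3 - h * slant x) - x $ 2"
  by (simp_all add: right_diff_distrib h_times_height_BDC height_ABD_def act_units
      Minv_slant_coordinates linear_diff[OF linear_slant] linear_scale[OF linear_slant])
    (simp_all add: algebra_simps)

lemma neighbours_BDC:
  "h * (height_ABD x - height_BDC x) = (h * (h - 1) - 1) * - slant x"
  "h * (height_ABD (act beta x) - height_BDC x) = h * x $ 2 + slant x"
  "h * (height_ABD (act alpha_inv x) - height_BDC x)
    = (h * k - 1) * (h * k * x $ 3 - h * x $ 2 - slant x)"
  by (simp_all add: right_diff_distrib h_times_height_BDC height_ABD_def act_units
      Minv_slant_coordinates M_slant_coordinates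
      linear_add[OF linear_slant] linear_scale[OF linear_slant])
    (simp_all add: algebra_simps)

lemma neighbour_factors_pos: "0 < h * (h - 1) - 1" "0 < h * k - 1"
  using mult_mono[of 2 h 1 "h - 1"] mult_mono[of 2 h 1 k] h_ge_2 k_ge_1 by simp_all

lemma in_cone_ABD:
  assumes min: "height_ABD x \<le> height_BDC x" "height_ABD x \<le> height_BDC (act alpha x)"
      "height_ABD x \<le> height_BDC (act beta_inv x)"
    and pos: "0 < height_ABD x"
  obtains q where "q \<in> convex hull {A, B, D}" "x = height_ABD x *\<^sub>R q"
proof -
  let ?A = "slant x" and ?B = "x $ 3 - h * slant x - x $ 2 / k" and ?D = "x $ 2 / k"
  have "0 \<le> (h * (h - 1) - 1) * slant x" "0 \<le> (h * k - 1) * x $ 2"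
    "0 \<le> k * (x $ 3 - h * slant x) - x $ 2"
    using min h_ge_2 by (simp_all flip: neighbours_ABD)
  then have "0 \<le> slant x" "0 \<le> x $ 2" "0 \<le> k * (x $ 3 - h * slant x) - x $ 2"
    using neighbour_factors_pos by (simp_all only: zero_le_mult_iff) linarith+
  then have coords: "0 \<le> ?A" "0 \<le> ?B" "0 \<le> ?D"
    using k_ge_1 by (simp_all add: field_simps)
  have sum: "height_ABD x = ?A + ?B + ?D" by (simp add: height_ABD_def algebra_simps)
  then obtain q where "q \<in> convex hull {A, B, D}"
    "?A *\<^sub>R A + ?B *\<^sub>R B + ?D *\<^sub>R D = height_ABD x *\<^sub>R q"
    using convex_hull_3_scaled[OF coords, of A B D] pos by metis
  then show ?thesis using that ABD_coordinates[of x] by simp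
qed

lemma in_cone_BDC:
  assumes min: "height_BDC x \<le> height_ABD x" "height_BDC x \<le> height_ABD (act beta x)"
      "height_BDC x \<le> height_ABD (act alpha_inv x)"
    and pos: "0 < height_BDC x"
  obtains q where "q \<in> convex hull {B, D, C}" "x = height_BDC x *\<^sub>R q"
proof -
  let ?B = "x $ 3 - (x $ 2 + slant x / h) / k" and ?D = "(x $ 2 + slant x / h) / k"
    and ?C = "- slant x / h"
  have "0 \<le> (h * (h - 1) - 1) * - slant x" "0 \<le> h * x $ 2 + slant x"
    "0 \<le> (h * k - 1) * (h * k * x $ 3 - h * x $ 2 - slant x)"
    using min h_ge_2 by (simp_all only: flip: neighbours_BDC) simp_all
  then have "slant x \<le> 0" "0 \<le> h * x $ 2 + slant x" "0 \<le> h * k * x $ 3 - h * x $ 2 - slant x"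
    using neighbour_factors_pos by (simp_all only: zero_le_mult_iff) linarith+
  then have coords: "0 \<le> ?B" "0 \<le> ?D" "0 \<le> ?C"
    using h_ge_2 k_ge_1 by (simp_all add: field_simps)
  have sum: "height_BDC x = ?B + ?D + ?C" by (simp add: height_BDC_def)
  then obtain q where "q \<in> convex hull {B, D, C}"
    "?B *\<^sub>R B + ?D *\<^sub>R D + ?C *\<^sub>R C = height_BDC x *\<^sub>R q"
    using convex_hull_3_scaled[OF coords, of B D C] pos by metis
  then show ?thesis using that BDC_coordinates[of x] by simp
qed

section \<open>The sail is tiled by translates of the two triangles\<close>

lemma height_ABD_eigvec_pos:
  assumes t: "t \<in> T"
  shows "0 < height_ABD (eigvec t) / emb t (eigvec t)"
proof -
  have "(t + h) * height_ABD (eigvec t) = t + h - (h - 1) * (t * (t + h) * (t - k))"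
    by (simp add: height_ABD_def slant_def eigvec_def algebra_simps power2_eq_square)
  then have height: "(t + h) * height_ABD (eigvec t) = t + 1"
    unfolding unit_relation[OF t] by simp
  have bounds: "t1 < -1" "-1 < t2" "t2 < 0" "0 < t3"
    using t1_bounds t2_bounds t3_bound b_nonneg by simp_all
  consider "t = t1" | "t = t2" | "t = t3" using t by (auto simp: T_def)
  then have "0 < (t + 1) / emb t (eigvec t)"
  proof cases
    case 1
    have "t1 * (t1 - t2) * (t1 - t3) < 0"
      using bounds by (intro mult_pos_neg mult_neg_neg) simp_all
    then show ?thesis using 1 bounds by (simp add: emb_eigvec_same divide_neg_neg)
  next
    case 2
    have "0 < t2 * (t2 - t1) * (t2 - t3)"
      using bounds by (intro mult_neg_neg mult_neg_pos) simp_all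
    then show ?thesis using 2 bounds by (simp add: emb_eigvec_same)
  next
    case 3
    have "0 < t3 * (t3 - t1) * (t3 - t2)"
      using bounds by simp
    then show ?thesis using 3 bounds by (simp add: emb_eigvec_same)
  qed
  then have "0 < (t + h) * (height_ABD (eigvec t) / emb t (eigvec t))"
    unfolding height[symmetric] by simp
  then show ?thesis using plus_h_pos[OF t] by (rule zero_less_mult_pos)
qed

lemma height_ABD_pos:
  assumes "x \<in> orthant_points"
  shows "0 < height_ABD x"
proof -
  have x: "x \<noteq> 0" "\<And>t. t \<in> T \<Longrightarrow> 0 \<le> emb t x" using assms by (auto simp: orthant_points_iff)
  let ?c = "\<lambda>t. height_ABD (eigvec t) / emb t (eigvec t)"
  have "height_ABD x = height_ABD (\<Sum>t\<in>T. (emb t x / emb t (eigvec t)) *\<^sub>R eigvec t)"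
    by (simp flip: eigvec_expansion)
  also have "\<dots> = (\<Sum>t\<in>T. emb t x * ?c t)"
    by (simp add: linear_sum[OF linear_height(1)] linear_scale[OF linear_height(1)])
  also have "0 < \<dots>"
  proof -
    obtain t where t: "t \<in> T" "emb t x \<noteq> 0" using eq_0_if_emb_eq_0 x(1) by blast
    show ?thesis
    proof (rule sum_pos2)
      have "0 < emb t x" using t x(2)[OF t(1)] by simp
      then show "0 < emb t x * ?c t" using height_ABD_eigvec_pos[OF t(1)] by (rule mult_pos_pos)
      show "0 \<le> emb t x * ?c t" if "t \<in> T" for t
        using x(2)[OF that] less_imp_le[OF height_ABD_eigvec_pos[OF that]]
        by (rule mult_nonneg_nonneg)
    qed (use t in \<open>simp_all add: T_def\<close>)
  qed
  finally show ?thesis .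
qed

lemma slant_Ints: "x \<in> orthant_points \<Longrightarrow> slant x \<in> \<int>"
  by (simp add: slant_def k_def orthant_points_iff)

lemma height_ABD_ge_1:
  assumes "x \<in> orthant_points"
  shows "1 \<le> height_ABD x"
proof -
  have "height_ABD x \<in> \<int>"
    using assms slant_Ints[OF assms] by (simp add: height_ABD_def h_def orthant_points_iff)
  then show ?thesis using Ints_nonzero_abs_ge1[of "height_ABD x"] height_ABD_pos[OF assms] by simp
qed

text \<open>Outside the cone over \<open>BDC\<close> the height is bounded below by that of a neighbouring triangle;
  inside the cone the third coordinate is a positive integer.\<close>

lemma height_BDC_ge_1:
  assumes x: "x \<in> orthant_points"
  shows "1 \<le> height_BDC x"
proof -
  have ge: "1 \<le> height_BDC x" if "N \<in> Xi_bar M" "h * (height_ABD (act N x) - height_BDC x) \<le> 0"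
    for N
  proof -
    have "height_ABD (act N x) \<le> height_BDC x"
      using that(2) h_ge_2 by (simp add: mult_le_0_iff)
    moreover have "1 \<le> height_ABD (act N x)"
      using x act_orthant_points[OF that(1)] by (intro height_ABD_ge_1) blast
    ultimately show ?thesis by simp
  qed
  consider "0 \<le> slant x" | "h * x $ 2 + slant x \<le> 0" | "h * k * x $ 3 - h * x $ 2 - slant x \<le> 0"
    | "slant x < 0" "0 < h * x $ 2 + slant x" "0 < h * k * x $ 3 - h * x $ 2 - slant x"
    by linarith
  then show ?thesis
  proof cases
    case 1
    then show ?thesis
      using ge[OF Xi_bar_one] neighbours_BDC(1)[of x] neighbour_factors_pos
      by (simp add: act_mat mult_nonneg_nonneg)
  next
    case 2
    then show ?thesis using ge[OF beta_Xi] neighbours_BDC(2) by simp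
  next
    case 3
    then show ?thesis
      using ge[OF alpha_inv_Xi] neighbours_BDC(3)[of x] neighbour_factors_pos
      by (simp add: mult_nonneg_nonpos)
  next
    case 4
    then have "0 < h * k * x $ 3" by linarith
    moreover have "0 < h * k" using h_ge_2 k_ge_1 by simp
    ultimately have "0 < x $ 3" by (rule zero_less_mult_pos)
    then have "1 \<le> x $ 3" using x Ints_nonzero_abs_ge1[of "x $ 3"] by (simp add: orthant_points_iff)
    moreover have "slant x / h < 0" using 4(1) h_ge_2 by (simp add: divide_neg_pos)
    ultimately show ?thesis by (simp add: height_BDC_def)
  qed
qed

definition tiles :: "((real^3 \<Rightarrow> real) \<times> (real^3) set) set" where
  "tiles = {(height_ABD, {A, B, D}), (height_BDC, {B, D, C})}"

lemma linear_tile_height: "(g, \<Delta>) \<in> tiles \<Longrightarrow> linear g"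
  using linear_height by (auto simp: tiles_def)

lemma tile_height_ge_1: "(g, \<Delta>) \<in> tiles \<Longrightarrow> x \<in> orthant_points \<Longrightarrow> 1 \<le> g x"
  using height_ABD_ge_1 height_BDC_ge_1 by (auto simp: tiles_def)

lemma tile_height_vertex: "(g, \<Delta>) \<in> tiles \<Longrightarrow> v \<in> \<Delta> \<Longrightarrow> g v = 1"
  using height_vertices by (auto simp: tiles_def)

lemma tile_subset: "(g, \<Delta>) \<in> tiles \<Longrightarrow> \<Delta> \<subseteq> interior_points"
  using vertices_interior_points unfolding tiles_def by blast

lemma tile_independent:
  assumes "(g, \<Delta>) \<in> tiles"
  shows "independent \<Delta>"
proof (rule card_le_dim_spanning)
  have "x \<in> span {A, B, D}" for x
    by (subst ABD_coordinates) (intro span_add span_scale span_base; simp)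
  moreover have "x \<in> span {B, D, C}" for x
    by (subst BDC_coordinates) (intro span_add span_scale span_base; simp)
  ultimately show "UNIV \<subseteq> span \<Delta>" using assms by (auto simp: tiles_def)
  show "card \<Delta> \<le> dim (UNIV :: (real^3) set)"
    using assms by (auto simp: tiles_def card_insert_if)
qed (use assms in \<open>auto simp: tiles_def\<close>)

definition heights :: "(real^3 \<Rightarrow> real) set" where
  "heights = {\<lambda>x. g (act N x) | g \<Delta> N. (g, \<Delta>) \<in> tiles \<and> N \<in> Xi_bar M}"

lemma tile_height_act_in_heights: "(g, \<Delta>) \<in> tiles \<Longrightarrow> N \<in> Xi_bar M \<Longrightarrow> (\<lambda>x. g (act N x)) \<in> heights"
  unfolding heights_def by blast

lemma heights_act:
  assumes "f \<in> heights" "N \<in> Xi_bar M"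
  shows "(\<lambda>x. f (act N x)) \<in> heights"
proof -
  obtain g \<Delta> K where f: "f = (\<lambda>x. g (act K x))" and g: "(g, \<Delta>) \<in> tiles" and K: "K \<in> Xi_bar M"
    using assms(1) unfolding heights_def by blast
  have "(\<lambda>x. f (act N x)) = (\<lambda>x. g (act (K ** N) x))" by (simp add: f act_mult)
  then show ?thesis using tile_height_act_in_heights[OF g Xi_bar_mult[OF K assms(2)]] by simp
qed

lemma linear_heights:
  assumes "f \<in> heights"
  shows "linear f"
proof -
  obtain g \<Delta> N where f: "f = (\<lambda>x. g (act N x))" and g: "(g, \<Delta>) \<in> tiles"
    using assms unfolding heights_def by blast
  then show ?thesis
    using linear_compose[OF linear_act linear_tile_height[OF g]] by (simp add: o_def)
qed

lemma heights_ge_1_on_orthant_points: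
  assumes "f \<in> heights" and x: "x \<in> orthant_points"
  shows "1 \<le> f x"
proof -
  obtain g \<Delta> N where f: "f = (\<lambda>x. g (act N x))" and g: "(g, \<Delta>) \<in> tiles" and N: "N \<in> Xi_bar M"
    using assms(1) unfolding heights_def by blast
  have "act N x \<in> orthant_points" using act_orthant_points[OF N] x by blast
  then show ?thesis unfolding f by (rule tile_height_ge_1[OF g])
qed

lemma heights_ge_1_on_H:
  assumes f: "f \<in> heights" and x: "x \<in> H"
  shows "1 \<le> f x"
proof -
  have "orthant_points \<subseteq> f -` {1..}" using heights_ge_1_on_orthant_points[OF f] by auto
  then have "H \<subseteq> f -` {1..}"
    unfolding H_eq_convex_hull
    by (intro hull_minimal convex_linear_vimage linear_heights[OF f] convex_real_interval)
  then show ?thesis using x by auto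
qed

lemma finite_below_heights:
  assumes x: "x \<in> orthant_points"
  shows "finite_below ((\<lambda>f. f x) ` heights)"
  unfolding finite_below_def
proof
  fix K
  have "(\<lambda>f. f x) ` heights \<inter> {..K} \<subseteq> (\<lambda>i. of_int i / h) ` {0..\<lfloor>h * K\<rfloor>}"
  proof
    fix r assume "r \<in> (\<lambda>f. f x) ` heights \<inter> {..K}"
    then obtain f where f: "f \<in> heights" "r = f x" "r \<le> K" by blast
    then obtain g \<Delta> N where g: "r = g (act N x)" "(g, \<Delta>) \<in> tiles" "N \<in> Xi_bar M"
      unfolding heights_def by blast
    have y: "act N x \<in> orthant_points" using act_orthant_points[OF g(3)] x by blast
    have "h * height_ABD (act N x) \<in> \<int>" "h * height_BDC (act N x) \<in> \<int>"
      using y slant_Ints[OF y] unfolding h_times_height_BDC height_ABD_def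
      by (simp_all add: h_def orthant_points_iff)
    then have "h * r \<in> \<int>" using g by (auto simp: tiles_def)
    then obtain i where i: "h * r = of_int i" by (rule Ints_cases)
    have "1 \<le> r" using heights_ge_1_on_orthant_points[OF f(1) x] f(2) by simp
    then have "0 \<le> h * r" "h * r \<le> h * K" using f(3) h_ge_2 by simp_all
    then have "i \<in> {0..\<lfloor>h * K\<rfloor>}" unfolding i by (simp add: le_floor_iff)
    moreover have "r = of_int i / h" using i h_ge_2 by (simp add: field_simps)
    ultimately show "r \<in> (\<lambda>i. of_int i / h) ` {0..\<lfloor>h * K\<rfloor>}" by blast
  qed
  then show "finite ((\<lambda>f. f x) ` heights \<inter> {..K})" by (rule finite_subset) simp
qed

lemma in_cone_of_lowest_tile:
  assumes tile: "(g, \<Delta>) \<in> tiles" and pos: "0 < g x" and min: "\<And>f. f \<in> heights \<Longrightarrow> g x \<le> f x"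
  obtains q where "q \<in> convex hull \<Delta>" "x = g x *\<^sub>R q"
proof -
  have ABD: "g x \<le> height_ABD (act N x)" and BDC: "g x \<le> height_BDC (act N x)"
    if "N \<in> Xi_bar M" for N
    using min tile_height_act_in_heights[OF _ that] by (auto simp: tiles_def)
  have this_ABD: "g x \<le> height_ABD x" and this_BDC: "g x \<le> height_BDC x"
    using ABD[OF Xi_bar_one] BDC[OF Xi_bar_one] by (simp_all add: act_mat)
  consider "g = height_ABD" "\<Delta> = {A, B, D}" | "g = height_BDC" "\<Delta> = {B, D, C}"
    using tile by (auto simp: tiles_def)
  then show ?thesis
  proof cases
    case 1
    then show ?thesis
      using in_cone_ABD[of x] this_BDC BDC[OF alpha_Xi] BDC[OF beta_inv_Xi] pos that by metis
  next
    case 2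
    then show ?thesis
      using in_cone_BDC[of x] this_ABD ABD[OF beta_Xi] ABD[OF alpha_inv_Xi] pos that by metis
  qed
qed

lemma tile_face_of_H:
  assumes tile: "(g, \<Delta>) \<in> tiles"
  shows "convex hull \<Delta> face_of H"
proof -
  let ?F = "{x \<in> orthant_points. g x = 1}"
  have "?F \<subseteq> convex hull \<Delta>"
  proof
    fix x assume x: "x \<in> ?F"
    have "g x \<le> f x" if "f \<in> heights" for f using heights_ge_1_on_orthant_points[OF that] x by simp
    then obtain q where "q \<in> convex hull \<Delta>" "x = g x *\<^sub>R q"
      using in_cone_of_lowest_tile[OF tile, of x] x by auto
    then show "x \<in> convex hull \<Delta>" using x by simp
  qed
  moreover have "\<Delta> \<subseteq> ?F" using tile_subset[OF tile] tile_height_vertex[OF tile] by blast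
  ultimately have "convex hull ?F = convex hull \<Delta>"
    by (metis convex_convex_hull hull_minimal hull_mono subset_antisym)
  moreover have "convex hull ?F face_of convex hull orthant_points"
    using linear_tile_height[OF tile] tile_height_ge_1[OF tile]
    by (rule convex_hull_min_level_face_of)
  ultimately show ?thesis by (simp add: H_eq_convex_hull)
qed

lemma cones_cover_H:
  assumes x: "x \<in> H"
  obtains N g \<Delta> q s where "N \<in> Xi_bar M" "(g, \<Delta>) \<in> tiles" "q \<in> convex hull \<Delta>"
    "1 \<le> s" "act N x = s *\<^sub>R q"
proof -
  have nonneg: "0 \<le> f y" if "f \<in> heights" "y \<in> orthant_points" for f y
    using heights_ge_1_on_orthant_points[OF that] by simp
  have "(height_ABD, {A, B, D}) \<in> tiles" by (simp add: tiles_def)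
  then have "heights \<noteq> {}" using tile_height_act_in_heights[OF _ Xi_bar_one] by blast
  with linear_heights nonneg finite_below_heights have "\<exists>f\<in>heights. \<forall>f'\<in>heights. f x \<le> f' x"
    using x[unfolded H_eq_convex_hull] by (rule convex_hull_attains_min_functional)
  then obtain f where f: "f \<in> heights" "\<And>f'. f' \<in> heights \<Longrightarrow> f x \<le> f' x" by blast
  then obtain g \<Delta> N where g: "f = (\<lambda>x. g (act N x))" "(g, \<Delta>) \<in> tiles" and N: "N \<in> Xi_bar M"
    unfolding heights_def by blast
  have "g (act N x) \<le> f' (act N x)" if "f' \<in> heights" for f'
    using f(2)[OF heights_act[OF that N]] by (simp add: g(1))
  moreover have "1 \<le> g (act N x)" using heights_ge_1_on_H[OF f(1) x] by (simp add: g(1))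
  ultimately obtain q where "q \<in> convex hull \<Delta>" "act N x = g (act N x) *\<^sub>R q"
    using in_cone_of_lowest_tile[OF g(2), of "act N x"] by auto
  then show ?thesis using that[OF N g(2)] \<open>1 \<le> g (act N x)\<close> by blast
qed

lemma rel_interior_act: "N \<in> Xi_bar M \<Longrightarrow> rel_interior (act N ` F) = act N ` rel_interior F"
  by (simp add: rel_interior_injective_linear_image inj_act)

lemma sail_face_normal_form:
  assumes F: "F face_of H" "F \<noteq> {}" "F \<subseteq> frontier H"
  obtains N g \<Delta> V where "N \<in> Xi_bar M" "(g, \<Delta>) \<in> tiles" "V \<subseteq> \<Delta>" "V \<noteq> {}" "act N ` F = convex hull V"
proof -
  have "convex F" using F(1) face_of_imp_convex by blast
  then obtain x where x: "x \<in> rel_interior F" using rel_interior_eq_empty F(2) by blast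
  then have "x \<in> F" using rel_interior_subset by blast
  then have xH: "x \<in> H" "x \<notin> interior H" using F face_of_imp_subset by (auto simp: frontier_def)
  obtain N g \<Delta> q s where N: "N \<in> Xi_bar M" and tile: "(g, \<Delta>) \<in> tiles"
    and q: "q \<in> convex hull \<Delta>" "act N x = s *\<^sub>R q" and s: "1 \<le> s"
    using cones_cover_H[OF xH(1)] by metis
  have NH: "act N x \<in> H" using act_H[OF N] xH(1) by blast
  have "act N ` interior H = interior H"
    using interior_injective_linear_image[OF linear_act inj_act[OF N], of H] act_H[OF N] by simp
  then have "act N x \<notin> interior H" using xH(2) inj_image_mem_iff[OF inj_act[OF N]] by metis
  then have "\<not> 1 < s"
    using scaleR_in_interior_H[OF tile_subset[OF tile] q(1), of s] NH q(2) by auto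
  then have "s = 1" using s by simp
  then have Nx: "act N x \<in> convex hull \<Delta>" using q by simp
  let ?F = "act N ` F"
  have face: "?F face_of H"
    using F(1) face_of_linear_image[OF linear_act inj_act[OF N], of F H] act_H[OF N] by simp
  have "act N x \<in> rel_interior ?F"
    using x by (simp add: rel_interior_act[OF N])
  then have sub: "?F \<subseteq> convex hull \<Delta>"
    using subset_of_face_of[OF tile_face_of_H[OF tile] face_of_imp_subset[OF face]] Nx by blast
  have "?F face_of convex hull \<Delta>"
    using face sub face_of_imp_subset[OF tile_face_of_H[OF tile]] by (rule face_of_subset)
  then obtain V where V: "V \<subseteq> \<Delta>" "?F = convex hull V"
    using tile_independent[OF tile] affine_dependent_imp_dependent
      face_of_convex_hull_affine_independent by metis
  then have "V \<noteq> {}" using F(2) by auto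
  then show ?thesis using that[OF N tile V(1)] V(2) by simp
qed

section \<open>The fundamental domain\<close>

definition domain_simplices :: "(real^3) set set" where
  "domain_simplices = {{A}, {A, B}, {A, D}, {B, D}, {A, B, D}, {B, D, C}}"

definition open_simplex :: "(real^3) set \<Rightarrow> (real^3) set" where
  "open_simplex V = rel_interior (convex hull V)"

lemma domain_simplex_in_tile:
  assumes "V \<in> domain_simplices"
  obtains g \<Delta> where "(g, \<Delta>) \<in> tiles" "V \<subseteq> \<Delta>" "V \<noteq> {}"
  using assms unfolding domain_simplices_def tiles_def by blast

lemma distinct_vertices: "A \<noteq> B" "A \<noteq> C" "A \<noteq> D" "B \<noteq> C" "B \<noteq> D" "C \<noteq> D"
  using h_ge_2 k_ge_1 unfolding vertices_hk B_def by (simp_all add: vec_eq_iff forall_3)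

lemma open_simplex_image_domain_simplices:
  "open_simplex ` domain_simplices = {{A}, open_segment A B, open_segment A D, open_segment B D,
     rel_interior (convex hull {A, B, D}), rel_interior (convex hull {B, D, C})}"
  using distinct_vertices
  by (simp add: domain_simplices_def open_simplex_def rel_interior_closed_segment
      flip: segment_convex_hull)

lemma affine_independent_if_subset_tile:
  assumes "(g, \<Delta>) \<in> tiles" "V \<subseteq> \<Delta>"
  shows "\<not> affine_dependent V"
  using assms tile_independent independent_mono affine_dependent_imp_dependent by metis

lemma open_simplex_in_sail_faces:
  assumes "V \<in> domain_simplices"
  shows "open_simplex V \<in> sail_faces pos_orthant"
proof -
  obtain g \<Delta> where tile: "(g, \<Delta>) \<in> tiles" and V: "V \<subseteq> \<Delta>" "V \<noteq> {}"
    using assms by (rule domain_simplex_in_tile)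
  have "\<not> affine_dependent \<Delta>" using tile subset_refl by (rule affine_independent_if_subset_tile)
  then have "convex hull V face_of convex hull \<Delta>"
    using face_of_convex_hull_affine_independent V(1) by blast
  then have face: "convex hull V face_of H" using tile_face_of_H[OF tile] by (rule face_of_trans)
  have "convex hull V \<subseteq> g -` {1}"
    using V(1) tile_height_vertex[OF tile]
    by (intro hull_minimal convex_linear_vimage linear_tile_height[OF tile] convex_singleton) auto
  moreover obtain v where v: "v \<in> V" using V(2) by blast
  then have "g (2 *\<^sub>R v) = 2"
    using V(1) tile_height_vertex[OF tile]
    by (auto simp: linear_scale[OF linear_tile_height[OF tile]])
  moreover have "2 *\<^sub>R v \<in> H"
    using scaleR_orthant_points[of v 2] tile_subset[OF tile] V(1) v
    by (auto intro: orthant_points_in_H)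
  ultimately have "convex hull V \<noteq> H" by fastforce
  then have "convex hull V \<inter> interior H = {}" using face face_of_disjoint_interior by blast
  then have "convex hull V \<subseteq> frontier H"
    using face_of_imp_subset[OF face] closure_subset by (auto simp: frontier_def)
  then show ?thesis
    using face V(2) unfolding sail_faces_def open_simplex_def sail_def by auto
qed

lemma act_open_simplex: "N \<in> Xi_bar M \<Longrightarrow> act N ` open_simplex V = open_simplex (act N ` V)"
  by (simp add: open_simplex_def rel_interior_act flip: convex_hull_linear_image)

lemma subset_tile_normal_form:
  assumes "(g, \<Delta>) \<in> tiles" "V \<subseteq> \<Delta>" "V \<noteq> {}"
  obtains N where "N \<in> Xi_bar M" "act N ` V \<in> domain_simplices"
proof -
  have "V \<in> Pow {A, B, D} \<or> V \<in> Pow {B, D, C}" using assms by (auto simp: tiles_def)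
  then consider "V \<in> domain_simplices" | "V = {B} \<or> V = {B, C}" | "V = {D} \<or> V = {D, C}" | "V = {C}"
    using assms(3) unfolding domain_simplices_def Pow_insert Pow_empty by fastforce
  then show ?thesis
  proof cases
    case 1
    then show ?thesis using that[OF Xi_bar_one] by (simp add: act_mat)
  next
    case 2
    then show ?thesis using that[OF beta_Xi] by (auto simp: unit_images domain_simplices_def)
  next
    case 3
    then show ?thesis
      using that[OF alpha_inv_Xi] by (auto simp: unit_inverse_images domain_simplices_def)
  next
    case 4
    then show ?thesis
      using that[OF Xi_bar_mult[OF beta_Xi alpha_inv_Xi]]
      by (simp add: act_mult unit_inverse_images unit_images domain_simplices_def)
  qed
qed

lemma ex_representative:
  assumes "F \<in> sail_faces pos_orthant"
  shows "\<exists>G \<in> open_simplex ` domain_simplices. G \<in> face_orbit M F"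
proof -
  obtain E where E: "F = rel_interior E" "E face_of H" "E \<noteq> {}" "E \<subseteq> frontier H"
    using assms by (auto simp: sail_faces_def sail_def)
  obtain N g \<Delta> V where N: "N \<in> Xi_bar M" and V: "(g, \<Delta>) \<in> tiles" "V \<subseteq> \<Delta>" "V \<noteq> {}"
    and NE: "act N ` E = convex hull V"
    using sail_face_normal_form[OF E(2-4)] by metis
  obtain K where K: "K \<in> Xi_bar M" "act K ` V \<in> domain_simplices"
    using subset_tile_normal_form[OF V] by metis
  have "act (K ** N) ` F = act K ` (act N ` F)" by (simp add: image_image act_mult)
  also have "act N ` F = open_simplex V"
    unfolding E(1) open_simplex_def NE[symmetric]
    by (simp add: rel_interior_act[OF N])
  also have "act K ` open_simplex V = open_simplex (act K ` V)" by (rule act_open_simplex[OF K(1)])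
  finally have "open_simplex (act K ` V) \<in> face_orbit M F"
    unfolding face_orbit_def using Xi_bar_mult[OF K(1) N] by blast
  then show ?thesis using K(2) by blast
qed

lemma log_coordinates:
  obtains \<phi> \<psi> :: "real^3 \<Rightarrow> real"
  where "\<forall>N\<in>Xi_bar M. \<forall>x\<in>pos_orthant. \<phi> (act N x) = \<phi> (act N B) + \<phi> x"
    and "\<forall>N\<in>Xi_bar M. \<forall>x\<in>pos_orthant. \<psi> (act N x) = \<psi> (act N B) + \<psi> x"
    and "\<phi> A = 1" "\<phi> B = 0" "\<phi> C = 0" "\<phi> D = 1" "\<psi> A = 0" "\<psi> B = 0" "\<psi> C = 1" "\<psi> D = 1"
proof -
  define f g where "f x = ln (emb t2 x)" and "g x = ln (emb t3 x)" for x
  have T: "t2 \<in> T" "t3 \<in> T" by (simp_all add: T_def)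
  have f_act: "f (act N x) = f (act N B) + f x" and g_act: "g (act N x) = g (act N B) + g x"
    if "N \<in> Xi_bar M" "x \<in> pos_orthant" for N x
    using that eigval_pos[OF that(1)] T
    by (simp_all add: f_def g_def pos_orthant_def emb_act_Xi[OF that(1)] ln_mult_pos)
  have B: "f B = 0" "g B = 0" by (simp_all add: f_def g_def)
  have A: "A \<in> pos_orthant" using vertices_interior_points by blast
  have D: "f D = f C + f A" "g D = g C + g A"
    using f_act[OF alpha_Xi A] g_act[OF alpha_Xi A] by (simp_all add: unit_images)
  have "0 < f A" "0 < g A"
    using t2_bounds t3_bound h_ge_2 b_nonneg
    by (simp_all add: f_def g_def emb_A[OF T(1)] emb_A[OF T(2)])
  moreover have "0 < g C" using t3_bound b_nonneg by (simp add: g_def emb_C[OF T(2)] one_less_power)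
  moreover have "t2^2 < 1" using t2_bounds by (simp add: abs_square_less_1)
  then have "f C < 0" using t2_bounds by (simp add: f_def emb_C[OF T(1)])
  ultimately have "0 < f A * g C" "f C * g A < 0" by (simp_all add: mult_neg_pos)
  then have det: "f A * g C - f C * g A \<noteq> 0" by linarith
  define \<phi> \<psi> where "\<phi> x = (f x * g C - f C * g x) / (f A * g C - f C * g A)"
    and "\<psi> x = (f A * g x - f x * g A) / (f A * g C - f C * g A)" for x
  show ?thesis
  proof
    have "\<phi> (act N x) = \<phi> (act N B) + \<phi> x" "\<psi> (act N x) = \<psi> (act N B) + \<psi> x"
      if "N \<in> Xi_bar M" "x \<in> pos_orthant" for N x
      unfolding \<phi>_def \<psi>_def f_act[OF that] g_act[OF that]
      by (simp_all add: algebra_simps flip: add_divide_distrib)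
    then show "\<forall>N\<in>Xi_bar M. \<forall>x\<in>pos_orthant. \<phi> (act N x) = \<phi> (act N B) + \<phi> x"
      and "\<forall>N\<in>Xi_bar M. \<forall>x\<in>pos_orthant. \<psi> (act N x) = \<psi> (act N B) + \<psi> x" by blast+
    show "\<phi> A = 1" "\<phi> B = 0" "\<phi> C = 0" "\<phi> D = 1" "\<psi> A = 0" "\<psi> B = 0" "\<psi> C = 1" "\<psi> D = 1"
      using det by (simp_all add: \<phi>_def \<psi>_def B D algebra_simps)
  qed
qed

text \<open>In logarithmic coordinates the group acts by translations, and the six simplices are exactly
  those faces of the two triangles that are normalised by \<open>max \<phi> = 1\<close> and \<open>min \<psi> = 0\<close>.\<close>

lemma domain_simplices_inequivalent:
  assumes V: "V \<in> domain_simplices" and W: "act N ` V \<in> domain_simplices" and N: "N \<in> Xi_bar M"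
  shows "act N ` V = V"
proof -
  obtain \<phi> \<psi> :: "real^3 \<Rightarrow> real"
    where \<phi>: "\<forall>N\<in>Xi_bar M. \<forall>x\<in>pos_orthant. \<phi> (act N x) = \<phi> (act N B) + \<phi> x"
      and \<psi>: "\<forall>N\<in>Xi_bar M. \<forall>x\<in>pos_orthant. \<psi> (act N x) = \<psi> (act N B) + \<psi> x"
      and vertex: "\<phi> A = 1" "\<phi> B = 0" "\<phi> C = 0" "\<phi> D = 1" "\<psi> A = 0" "\<psi> B = 0" "\<psi> C = 1" "\<psi> D = 1"
    by (rule log_coordinates)
  have vertices: "U \<subseteq> {A, B, C, D}" if "U \<in> domain_simplices" for U
    using that by (auto simp: domain_simplices_def)
  then have "V \<subseteq> pos_orthant" using V vertices_interior_points by blast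
  then have translate: "\<phi> (act N v) = \<phi> (act N B) + \<phi> v" "\<psi> (act N v) = \<psi> (act N B) + \<psi> v"
    if "v \<in> V" for v
    using \<phi> \<psi> N that by blast+
  have max_\<phi>: "\<exists>v\<in>U. \<phi> v = 1" "\<forall>v\<in>U. \<phi> v \<le> 1" and min_\<psi>: "\<exists>v\<in>U. \<psi> v = 0" "\<forall>v\<in>U. 0 \<le> \<psi> v"
    if "U \<in> domain_simplices" for U
    using that by (auto simp: domain_simplices_def vertex)
  have "\<phi> (act N B) = 0"
  proof (rule antisym)
    show "\<phi> (act N B) \<le> 0" using max_\<phi>(1)[OF V] max_\<phi>(2)[OF W] translate by fastforce
    show "0 \<le> \<phi> (act N B)" using max_\<phi>(2)[OF V] max_\<phi>(1)[OF W] translate by fastforce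
  qed
  moreover have "\<psi> (act N B) = 0"
  proof (rule antisym)
    show "\<psi> (act N B) \<le> 0" using min_\<psi>(2)[OF V] min_\<psi>(1)[OF W] translate by fastforce
    show "0 \<le> \<psi> (act N B)" using min_\<psi>(1)[OF V] min_\<psi>(2)[OF W] translate by fastforce
  qed
  ultimately have fixed: "\<phi> (act N v) = \<phi> v" "\<psi> (act N v) = \<psi> v" if "v \<in> V" for v
    using translate[OF that] by simp_all
  have "act N v = v" if "v \<in> V" for v
  proof -
    have "v \<in> {A, B, C, D}" "act N v \<in> {A, B, C, D}"
      using that vertices[OF V] vertices[OF W] by blast+
    then show ?thesis using fixed[OF that] vertex by (elim insertE emptyE) simp_all
  qed
  then show ?thesis by simp
qed

lemma representative_unique:
  assumes G: "G \<in> open_simplex ` domain_simplices" "G \<in> face_orbit M F"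
    and G': "G' \<in> open_simplex ` domain_simplices" "G' \<in> face_orbit M F"
  shows "G = G'"
proof -
  obtain V W where V: "V \<in> domain_simplices" "G = open_simplex V"
    and W: "W \<in> domain_simplices" "G' = open_simplex W"
    using G(1) G'(1) by blast
  obtain N K where N: "N \<in> Xi_bar M" "G = act N ` F" and K: "K \<in> Xi_bar M" "G' = act K ` F"
    using G(2) G'(2) unfolding face_orbit_def by blast
  obtain K' where K': "K' \<in> Xi_bar M" "K' ** K = mat 1" using Xi_bar_inverse[OF K(1)] by metis
  let ?N = "N ** K'"
  have N': "?N \<in> Xi_bar M" using N(1) K'(1) by (rule Xi_bar_mult)
  have "act K' (act K x) = x" for x by (simp add: act_mult[symmetric] K'(2) act_mat)
  then have "act ?N ` G' = G" unfolding K(2) N(2) by (simp add: image_image act_mult)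
  then have eq: "open_simplex (act ?N ` W) = open_simplex V"
    unfolding W(2) V(2) act_open_simplex[OF N'] .
  obtain g \<Delta> where "(g, \<Delta>) \<in> tiles" "W \<subseteq> \<Delta>" using W(1) by (rule domain_simplex_in_tile)
  then have "independent W" using tile_independent independent_mono by blast
  moreover have "inj_on (act ?N) (span W)" using inj_act[OF N'] inj_on_subset by blast
  ultimately have "independent (act ?N ` W)" by (rule linear_independent_injective_image[OF linear_act])
  then have "\<not> affine_dependent (act ?N ` W)" using affine_dependent_imp_dependent by blast
  moreover obtain g \<Delta> where "(g, \<Delta>) \<in> tiles" "V \<subseteq> \<Delta>" using V(1) by (rule domain_simplex_in_tile)
  then have "\<not> affine_dependent V" by (rule affine_independent_if_subset_tile)
  ultimately have "act ?N ` W = V"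
    using eq unfolding open_simplex_def by (rule rel_interior_convex_hull_eq_imp_eq)
  then have "W = V" using domain_simplices_inequivalent[OF W(1) _ N'] V(1) by simp
  then show ?thesis using V W by simp
qed

lemma fundamental_domain_open_simplices:
  "fundamental_domain M pos_orthant (\<Union>(open_simplex ` domain_simplices))"
proof -
  have "\<exists>!G. G \<in> open_simplex ` domain_simplices \<and> G \<in> face_orbit M F"
    if "F \<in> sail_faces pos_orthant" for F
    using ex_representative[OF that] representative_unique by blast
  moreover have "open_simplex ` domain_simplices \<subseteq> sail_faces pos_orthant"
    using open_simplex_in_sail_faces by blast
  ultimately show ?thesis unfolding fundamental_domain_def by metis
qed

end

lemma sail_family_exists:
  fixes a b m n :: int
  assumes ab: "0 \<le> a" "0 \<le> b" and mn: "m = b - a - 1" "n = (a + 2) * (b + 1)"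
  shows "\<exists>t1 t2 t3. sail_family m n t1 t2 t3 a b"
proof -
  define h k where "h = real_of_int (a + 2)" and "k = real_of_int (b + 1)"
  have hk: "2 \<le> h" "1 \<le> k" using ab by (simp_all add: h_def k_def)
  define p :: "real poly" where "p = [:-1, - h * k, h - k, 1:]"
  have p: "poly p t = t * (t + h) * (t - k) - 1" for t
    by (simp add: p_def algebra_simps)
  have neg: "poly p (- h) < 0" "poly p 0 < 0" "poly p k < 0" by (simp_all add: p)
  have "1 * 2 \<le> (h - 1) * (k + 1)" using hk by (intro mult_mono) simp_all
  then have "0 < poly p (-1)" by (simp add: p algebra_simps)
  have "1 * 2 \<le> (k + 1) * (k + 1 + h)" using hk by (intro mult_mono) simp_all
  then have "0 < poly p (k + 1)" by (simp add: p)
  obtain x where x: "- h < x" "x < -1" "poly p x = 0"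
    using poly_IVT_pos[of "- h" "-1" p] neg \<open>0 < poly p (-1)\<close> hk by auto
  obtain y where y: "-1 < y" "y < 0" "poly p y = 0"
    using poly_IVT_neg[of "-1" 0 p] neg \<open>0 < poly p (-1)\<close> by auto
  obtain z where z: "k < z" "poly p z = 0"
    using poly_IVT_pos[of k "k + 1" p] neg \<open>0 < poly p (k + 1)\<close> by auto
  have distinct: "x \<noteq> y" "x \<noteq> z" "y \<noteq> z" using x y z hk by linarith+
  have "w^3 + (h - k) * w^2 + (- h * k) * w + (-1) = 0" if "poly p w = 0" for w
    using that by (simp add: p algebra_simps power2_eq_square power3_eq_cube)
  note coeffs = monic_cubic_vieta[OF distinct this[OF x(3)] this[OF y(3)] this[OF z(2)]]
  have "real_of_int m = k - h" "real_of_int n = h * k" by (simp_all add: h_def k_def mn)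
  then have vieta: "real_of_int m = x + y + z" "real_of_int n = - (x * y + x * z + y * z)"
    "x * y * z = 1"
    using coeffs by simp_all
  have "sail_family m n x y z a b"
    using assms distinct vieta x y z unfolding h_def k_def by unfold_locales
  then show ?thesis by blast
qed

theorem theorem5:
  fixes a b m n :: int and A B C D :: "real^3"
    and Q :: "(real^3) set" and \<F> :: "(real^3) set set"
  assumes "0 \<le> a" and "0 \<le> b"
    and "m = b - a - 1" and "n = (a + 2) * (b + 1)"
    and "A = vector [1, 0, of_int (a + 2)]"
    and "B = vector [0, 0, 1]"
    and "C = vector [of_int (b - a - 1), 1, 0]"
    and "D = vector [of_int ((b + 1)^2), of_int (b + 1), 1]"
    and "Q = orthant_at (A_mat m n) (vector [0, 0, 1])"
    and "\<F> = {{A}, open_segment A B, open_segment A D, open_segment B D,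
               rel_interior (convex hull {A, B, D}), rel_interior (convex hull {B, D, C})}"
  shows "\<F> \<subseteq> sail_faces Q \<and> fundamental_domain (A_mat m n) Q (\<Union>\<F>)"
proof -
  obtain t1 t2 t3 where "sail_family m n t1 t2 t3 a b"
    using sail_family_exists[OF assms(1-4)] by blast
  then interpret S: sail_family m n t1 t2 t3 a b .
  have vertices: "A = S.A" "B = S.B" "C = S.C" "D = S.D"
    by (simp_all only: assms(5-8) S.vertex_defs)
  have Q: "Q = S.pos_orthant"
    unfolding assms(9) by (rule S.orthant_at_B[unfolded S.B_def])
  have \<F>: "\<F> = S.open_simplex ` S.domain_simplices"
    unfolding assms(10) vertices by (rule S.open_simplex_image_domain_simplices[symmetric])
  show ?thesis
    unfolding Q \<F> using S.open_simplex_in_sail_faces S.fundamental_domain_open_simplices by blast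
qed

end
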